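(* Let $M$ be a geodesically complete connected oriented non-compact Riemannian $C^\infty$-manifold with Borel $\sigma$-algebra $\mathcal{B}(M)$, and let $\mu$ be a non-atomic Radon measure on $(M,\mathcal{B}(M))$ with $\mu(O)>0$ for every non-empty open set $O\subset M$ and $\mu(M)=\infty$. For each fixed $0<\alpha\le 1$, the functional $$C_\alpha(\varphi):=E_\alpha\left(\int_M (e^{i\varphi(x)}-1)\,d\mu(x)\right),\qquad \varphi\in\mathcal{D}(M),$$ is the characteristic functional of a probability measure $\pi_\mu^\alpha$ on the distribution space $\mathcal{D}'(M)$ equipped with the $\sigma$-algebra $\mathcal{C}_\sigma(\mathcal{D}'(M))$ generated by the cylinder sets; that is, there is a probability measure $\pi_\mu^\alpha$ on $(\mathcal{D}'(M),\mathcal{C}_\sigma(\mathcal{D}'(M)))$ with $$\int_{\mathcal{D}'(M)} e^{i\langle\omega,\varphi\rangle}\,d\pi_\mu^\alpha(\omega)=C_\alpha(\varphi)\quad\text{for all }\varphi\in\mathcal{D}(M).$$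
   Context: $E_\alpha$ denotes the Mittag-Leffler function of parameter $\alpha>0$: $E_\alpha(z)=\sum_{n=0}^\infty \frac{z^n}{\Gamma(\alpha n+1)}$, $z\in\mathbb{C}$, where $\Gamma(\cdot)$ is the Euler Gamma function. $\mathcal{D}(M)$ is the space of real-valued $C^\infty$-functions on $M$ with compact support, with its usual (nuclear) test-function topology; $\mathcal{D}'(M)$ is its topological dual, and $\langle\cdot,\cdot\rangle$ is the dual pairing. *)

theory Defs
  imports "HOL-Probability.Probability"
begin

section \<open>The Mittag-Leffler function\<close>

definition mittag_leffler :: "real \<Rightarrow> complex \<Rightarrow> complex"
  where "mittag_leffler \<alpha> z = (\<Sum>n. z ^ n / of_real (Gamma (\<alpha> * real n + 1)))"


section \<open>Smooth functions on open subsets of Euclidean space\<close>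

definition partial_deriv ::
    "'e::euclidean_space \<Rightarrow> ('e \<Rightarrow> 'f::real_normed_vector) \<Rightarrow> 'e \<Rightarrow> 'f"
  where "partial_deriv b f = (\<lambda>x. frechet_derivative f (at x) b)"

primrec iter_partial ::
    "'e::euclidean_space list \<Rightarrow> ('e \<Rightarrow> 'f::real_normed_vector) \<Rightarrow> 'e \<Rightarrow> 'f"
  where
    "iter_partial [] f = f"
  | "iter_partial (b # bs) f = partial_deriv b (iter_partial bs f)"

text \<open>
  Only meant for open \<open>S\<close>.  Total differentiability of every iterated partial derivative is
  required, which includes continuity of all of them and makes \<^const>\<open>frechet_derivative\<close>
  meaningful at every point of \<open>S\<close>.
\<close>

definition smooth_on :: "'e::euclidean_space set \<Rightarrow> ('e \<Rightarrow> 'f::real_normed_vector) \<Rightarrow> bool"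
  where "smooth_on S f \<longleftrightarrow> (\<forall>bs\<in>lists Basis. \<forall>x\<in>S. iter_partial bs f differentiable (at x))"


section \<open>Oriented smooth manifolds\<close>

text \<open>
  The underlying set of the manifold is the whole type \<open>'m\<close>; it is Hausdorff and second
  countable by its type class.  The dimension is \<open>CARD('n)\<close>.  A chart is a pair of its domain
  \<open>U\<close> and a coordinate map, whose values outside \<open>U\<close> are irrelevant.
\<close>

type_synonym ('m, 'n) chart = "'m set \<times> ('m \<Rightarrow> real ^ 'n)"

definition chart_inv :: "('m, 'n) chart \<Rightarrow> real ^ 'n \<Rightarrow> 'm"
  where "chart_inv c = inv_into (fst c) (snd c)"

definition is_chart :: "('m::topological_space, 'n::finite) chart \<Rightarrow> bool"
  where "is_chart c \<longleftrightarrow>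
    open (fst c) \<and> open (snd c ` fst c) \<and>
    homeomorphism (fst c) (snd c ` fst c) (snd c) (chart_inv c)"

definition transition ::
    "('m, 'n) chart \<Rightarrow> ('m, 'n) chart \<Rightarrow> real ^ 'n \<Rightarrow> real ^ 'n"
  where "transition c d = snd d \<circ> chart_inv c"

text \<open>Jacobian matrix at the point \<open>p\<close> of the change of coordinates from \<open>c\<close> to \<open>d\<close>.\<close>

definition jacobian_at ::
    "('m, 'n::finite) chart \<Rightarrow> ('m, 'n) chart \<Rightarrow> 'm \<Rightarrow> real ^ 'n ^ 'n"
  where "jacobian_at c d p = matrix (frechet_derivative (transition c d) (at (snd c p)))"

definition smooth_atlas :: "('m::topological_space, 'n::finite) chart set \<Rightarrow> bool"
  where "smooth_atlas A \<longleftrightarrow>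
    (\<forall>c\<in>A. is_chart c) \<and> (\<Union>c\<in>A. fst c) = UNIV \<and>
    (\<forall>c\<in>A. \<forall>d\<in>A. smooth_on (snd c ` (fst c \<inter> fst d)) (transition c d))"

text \<open>
  An oriented manifold is presented by an atlas of positively oriented charts.
\<close>

definition oriented_smooth_atlas :: "('m::topological_space, 'n::finite) chart set \<Rightarrow> bool"
  where "oriented_smooth_atlas A \<longleftrightarrow>
    smooth_atlas A \<and>
    (\<forall>c\<in>A. \<forall>d\<in>A. \<forall>p\<in>fst c \<inter> fst d. det (jacobian_at c d p) > 0)"


section \<open>Riemannian metrics and geodesics\<close>

text \<open>
  A metric is given by its components: \<open>g c p $ i $ j\<close> is the inner product of the \<open>i\<close>-th and
  \<open>j\<close>-th coordinate vector fields of the chart \<open>c\<close> at the point \<open>p\<close>.  The last conjunct is the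
  transformation law of a covariant 2-tensor.
\<close>

definition riemannian_metric ::
    "('m::topological_space, 'n::finite) chart set \<Rightarrow>
     (('m, 'n) chart \<Rightarrow> 'm \<Rightarrow> real ^ 'n ^ 'n) \<Rightarrow> bool"
  where "riemannian_metric A g \<longleftrightarrow>
    (\<forall>c\<in>A. smooth_on (snd c ` fst c) (g c \<circ> chart_inv c)) \<and>
    (\<forall>c\<in>A. \<forall>p\<in>fst c. transpose (g c p) = g c p \<and> (\<forall>v. v \<noteq> 0 \<longrightarrow> v \<bullet> (g c p *v v) > 0)) \<and>
    (\<forall>c\<in>A. \<forall>d\<in>A. \<forall>p\<in>fst c \<inter> fst d.
       g c p = transpose (jacobian_at c d p) ** g d p ** jacobian_at c d p)"

definition metric_deriv ::
    "(('m, 'n::finite) chart \<Rightarrow> 'm \<Rightarrow> real ^ 'n ^ 'n) \<Rightarrow> ('m, 'n) chart \<Rightarrow> 'm \<Rightarrow>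
     'n \<Rightarrow> 'n \<Rightarrow> 'n \<Rightarrow> real"
  where "metric_deriv g c p i j k =
    partial_deriv (axis i 1) (\<lambda>x. g c (chart_inv c x) $ j $ k) (snd c p)"

text \<open>The Christoffel symbol \<open>\<Gamma>\<^sup>k\<^sub>i\<^sub>j\<close> of the Levi-Civita connection.\<close>

definition christoffel ::
    "(('m, 'n::finite) chart \<Rightarrow> 'm \<Rightarrow> real ^ 'n ^ 'n) \<Rightarrow> ('m, 'n) chart \<Rightarrow> 'm \<Rightarrow>
     'n \<Rightarrow> 'n \<Rightarrow> 'n \<Rightarrow> real"
  where "christoffel g c p k i j =
    (\<Sum>l\<in>UNIV. matrix_inv (g c p) $ k $ l *
       (metric_deriv g c p i j l + metric_deriv g c p j i l - metric_deriv g c p l i j)) / 2"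

definition geodesic_on ::
    "('m::topological_space, 'n::finite) chart set \<Rightarrow>
     (('m, 'n) chart \<Rightarrow> 'm \<Rightarrow> real ^ 'n ^ 'n) \<Rightarrow> real set \<Rightarrow> (real \<Rightarrow> 'm) \<Rightarrow> bool"
  where "geodesic_on A g I \<gamma> \<longleftrightarrow>
    continuous_on I \<gamma> \<and>
    (\<forall>c\<in>A. smooth_on {t \<in> I. \<gamma> t \<in> fst c} (snd c \<circ> \<gamma>)) \<and>
    (\<forall>c\<in>A. \<forall>t\<in>I. \<gamma> t \<in> fst c \<longrightarrow>
       (let v = (\<lambda>s. vector_derivative (snd c \<circ> \<gamma>) (at s));
            a = vector_derivative v (at t)
        in \<forall>k. a $ k +
             (\<Sum>i\<in>UNIV. \<Sum>j\<in>UNIV. christoffel g c (\<gamma> t) k i j * v t $ i * v t $ j) = 0))"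

text \<open>Every maximal geodesic is defined on the whole real line.\<close>

definition geodesically_complete ::
    "('m::topological_space, 'n::finite) chart set \<Rightarrow>
     (('m, 'n) chart \<Rightarrow> 'm \<Rightarrow> real ^ 'n ^ 'n) \<Rightarrow> bool"
  where "geodesically_complete A g \<longleftrightarrow>
    (\<forall>I \<gamma>. open I \<and> is_interval I \<and> I \<noteq> {} \<and> geodesic_on A g I \<gamma> \<longrightarrow>
       (\<exists>\<gamma>'. geodesic_on A g UNIV \<gamma>' \<and> (\<forall>t\<in>I. \<gamma>' t = \<gamma> t)))"


section \<open>Test functions and distributions\<close>

definition test_functions :: "('m::topological_space, 'n::finite) chart set \<Rightarrow> ('m \<Rightarrow> real) set"
  where "test_functions A =
    {f. (\<forall>c\<in>A. smooth_on (snd c ` fst c) (f \<circ> chart_inv c)) \<and> compact (closure {x. f x \<noteq> 0})}"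

definition test_functions_on ::
    "('m::topological_space, 'n::finite) chart set \<Rightarrow> 'm set \<Rightarrow> ('m \<Rightarrow> real) set"
  where "test_functions_on A K = {f \<in> test_functions A. closure {x. f x \<noteq> 0} \<subseteq> K}"

definition seminorm_on :: "('m \<Rightarrow> real) set \<Rightarrow> (('m \<Rightarrow> real) \<Rightarrow> real) \<Rightarrow> bool"
  where "seminorm_on V p \<longleftrightarrow>
    (\<forall>f\<in>V. \<forall>h\<in>V. p (\<lambda>x. f x + h x) \<le> p f + p h) \<and>
    (\<forall>f\<in>V. \<forall>r. p (\<lambda>x. r * f x) = \<bar>r\<bar> * p f)"

text \<open>The locally convex topology on \<open>V\<close> generated by a family \<open>P\<close> of seminorms.\<close>

definition seminorm_topology ::
    "('m \<Rightarrow> real) set \<Rightarrow> (('m \<Rightarrow> real) \<Rightarrow> real) set \<Rightarrow> ('m \<Rightarrow> real) topology"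
  where "seminorm_topology V P = topology_generated_by
    {{h \<in> V. p (\<lambda>x. h x - f x) < e} | p f e. p \<in> P \<and> f \<in> V \<and> e > 0}"

definition deriv_seminorm ::
    "('m, 'n::finite) chart \<Rightarrow> 'm set \<Rightarrow> (real ^ 'n) list \<Rightarrow> ('m \<Rightarrow> real) \<Rightarrow> real"
  where "deriv_seminorm c L bs f = (SUP x\<in>L. \<bar>iter_partial bs (f \<circ> chart_inv c) (snd c x)\<bar>)"

text \<open>
  The Frechet topology of uniform convergence of all derivatives on compact subsets of charts.
\<close>

definition frechet_topology ::
    "('m::topological_space, 'n::finite) chart set \<Rightarrow> 'm set \<Rightarrow> ('m \<Rightarrow> real) topology"
  where "frechet_topology A K = seminorm_topology (test_functions_on A K)
    {deriv_seminorm c L bs | c L bs.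
       c \<in> A \<and> compact L \<and> L \<noteq> {} \<and> L \<subseteq> fst c \<and> bs \<in> lists Basis}"

text \<open>
  The locally convex inductive limit of the spaces of test functions supported in a compact set:
  the finest locally convex topology that makes all the inclusions continuous, hence generated
  by all seminorms whose restrictions are continuous.
\<close>

definition test_topology ::
    "('m::topological_space, 'n::finite) chart set \<Rightarrow> ('m \<Rightarrow> real) topology"
  where "test_topology A = seminorm_topology (test_functions A)
    {p. seminorm_on (test_functions A) p \<and>
        (\<forall>K. compact K \<longrightarrow> continuous_map (frechet_topology A K) euclideanreal p)}"

text \<open>
  Functionals are made extensional, so that each distribution has a unique representative.
  The dual pairing is function application.
\<close>

definition distributions ::
    "('m::topological_space, 'n::finite) chart set \<Rightarrow> (('m \<Rightarrow> real) \<Rightarrow> real) set"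
  where "distributions A =
    {\<omega> \<in> extensional (test_functions A).
       (\<forall>f\<in>test_functions A. \<forall>h\<in>test_functions A. \<omega> (\<lambda>x. f x + h x) = \<omega> f + \<omega> h) \<and>
       (\<forall>f\<in>test_functions A. \<forall>r. \<omega> (\<lambda>x. r * f x) = r * \<omega> f) \<and>
       continuous_map (test_topology A) euclideanreal \<omega>}"

definition cylinder_sets ::
    "('m::topological_space, 'n::finite) chart set \<Rightarrow> (('m \<Rightarrow> real) \<Rightarrow> real) set set"
  where "cylinder_sets A =
    {{\<omega> \<in> distributions A. (\<lambda>i\<in>{..<N}. \<omega> (\<phi> i)) \<in> B} | (N::nat) \<phi> B.
       \<phi> \<in> {..<N} \<rightarrow> test_functions A \<and> B \<in> sets (Pi\<^sub>M {..<N} (\<lambda>_. borel))}"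

definition cylinder_algebra ::
    "('m::topological_space, 'n::finite) chart set \<Rightarrow> (('m \<Rightarrow> real) \<Rightarrow> real) measure"
  where "cylinder_algebra A = sigma (distributions A) (cylinder_sets A)"

definition characteristic_functional ::
    "(('m \<Rightarrow> real) \<Rightarrow> real) measure \<Rightarrow> ('m \<Rightarrow> real) \<Rightarrow> complex"
  where "characteristic_functional \<pi> \<phi> = (LINT \<omega>|\<pi>. exp (\<i> * of_real (\<omega> \<phi>)))"


section \<open>Measures on the manifold\<close>

definition radon_measure :: "'m::topological_space measure \<Rightarrow> bool"
  where "radon_measure \<mu> \<longleftrightarrow>
    sets \<mu> = sets borel \<and>
    (\<forall>K. compact K \<longrightarrow> emeasure \<mu> K < \<infinity>) \<and>
    (\<forall>B\<in>sets \<mu>. emeasure \<mu> B = (SUP K\<in>{K. compact K \<and> K \<subseteq> B}. emeasure \<mu> K))"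

definition non_atomic :: "'m measure \<Rightarrow> bool"
  where "non_atomic \<mu> \<longleftrightarrow>
    (\<forall>S\<in>sets \<mu>. emeasure \<mu> S > 0 \<longrightarrow>
       (\<exists>T\<in>sets \<mu>. T \<subseteq> S \<and> 0 < emeasure \<mu> T \<and> emeasure \<mu> T < emeasure \<mu> S))"

definition C_functional :: "real \<Rightarrow> 'm measure \<Rightarrow> ('m \<Rightarrow> real) \<Rightarrow> complex"
  where "C_functional \<alpha> \<mu> \<phi> = mittag_leffler \<alpha> (LINT x|\<mu>. (exp (\<i> * of_real (\<phi> x)) - 1))"

end

theory Submission
  imports Defs "HOL-Real_Asymp.Real_Asymp"
begin

text \<open>
  If \<open>L\<close> is a random variable on \<open>[0, \<infinity>)\<close> with \<open>E (exp (z L)) = E\<^sub>\<alpha> z\<close>, then a Poisson point process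
  with the random intensity \<open>L \<mu>\<close> has the required characteristic functional, because conditionally
  on \<open>L\<close> it is \<open>exp (L \<integral>(exp (i \<phi>) - 1) d\<mu>)\<close>.  Every realization constructed below is a locally
  finite sum of point evaluations, hence a distribution, so no Bochner-Minlos theorem is needed.

  The law of \<open>L\<close> is a weak limit of \<open>K\<^sub>n / n\<^sup>\<alpha>\<close>, where \<open>K\<^sub>n\<close> is the number of occupied tables in the
  Chinese restaurant process with parameters \<open>(\<alpha>, 0)\<close>.  The rising factorial moments of \<open>K\<^sub>n\<close>
  satisfy a one-term recursion, and Euler's limit formula for \<open>\<Gamma>\<close> gives the limiting moments
  \<open>p! / \<Gamma>(\<alpha> p + 1)\<close>.
\<close>

section \<open>Weak limits of laws on the half-line with converging moments\<close>

lemma diff_min_le_square_div: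
  fixes x :: real
  assumes "x \<ge> 0" "R > 0"
  shows "x - min x R \<le> x\<^sup>2 / R"
proof (cases "x \<le> R")
  case True
  then show ?thesis using assms by simp
next
  case False
  then have "x * R \<le> x\<^sup>2" using assms by (simp add: power2_eq_square mult_left_mono)
  then have "x \<le> x\<^sup>2 / R" using assms by (simp add: pos_le_divide_eq)
  then show ?thesis using assms False by auto
qed

text \<open>Markov's inequality bounds the upper tail uniformly in \<open>n\<close>; the lower tail
  is null.\<close>

lemma tight_of_bounded_first_moment:
  fixes M :: "nat \<Rightarrow> real measure"
  assumes rd: "\<And>n. real_distribution (M n)"
    and nonneg: "\<And>n. AE x in M n. 0 \<le> x"
    and int: "\<And>n. integrable (M n) (\<lambda>x. x)"
    and bound: "\<And>n. (LINT x|M n. x) \<le> C"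
  shows "tight M"
  unfolding tight_def
proof (intro conjI allI impI rd)
  fix e :: real assume e: "e > 0"
  \<comment> \<open>The summand 1 keeps \<open>b\<close> positive when \<open>C = 0\<close> and
    makes the Markov bound strictly smaller than \<open>e\<close>.\<close>
  define b where "b = \<bar>C\<bar> / e + 1"
  have b: "b > 0" using e by (simp add: b_def add_nonneg_pos)
  show "\<exists>a b. a < b \<and> (\<forall>n. 1 - e < measure (M n) {a<..b})"
  proof (rule exI[of _ "-1"], rule exI[of _ b], intro conjI allI)
    show "- 1 < b" using b by simp
    fix n
    interpret real_distribution "M n" by (rule rd)
    have "prob {x \<in> space (M n). x \<ge> b} \<le> (LINT x|M n. x) / b"
      by (rule integral_Markov_inequality_measure[OF int, of "{}"]) (use nonneg b in auto)
    also have "\<dots> \<le> \<bar>C\<bar> / b" using bound[of n] b by (intro divide_right_mono) auto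
    also have "\<dots> < e"
      using e b by (simp add: b_def field_simps)
    finally have 1: "prob {x. x \<ge> b} < e" by simp
    have "1 = prob {x. 0 \<le> x}"
      using nonneg[of n] by (subst prob_eq_1[THEN iffD2]) auto
    also have "\<dots> \<le> prob ({- 1<..b} \<union> {x. x \<ge> b})"
      by (intro finite_measure_mono) auto
    also have "\<dots> \<le> prob {- 1<..b} + prob {x. x \<ge> b}"
      by (intro measure_Un_le) auto
    finally show "1 - e < prob {- 1<..b}" using 1 by linarith
  qed
qed

text \<open>
  Truncated powers pass to the weak limit, and the truncation error is controlled by the moment
  of twice the order.
\<close>

lemma stieltjes_moments_limit:
  fixes M :: "nat \<Rightarrow> real measure" and m :: "nat \<Rightarrow> real"
  assumes rd: "\<And>n. real_distribution (M n)"
    and nonneg: "\<And>n. AE x in M n. 0 \<le> x"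
    and int: "\<And>n p. integrable (M n) (\<lambda>x. x ^ p)"
    and lim: "\<And>p. (\<lambda>n. LINT x|M n. x ^ p) \<longlonglongrightarrow> m p"
  obtains N where "real_distribution N" "AE x in N. 0 \<le> x"
    "\<And>p. integrable N (\<lambda>x. x ^ p)" "\<And>p. (LINT x|N. x ^ p) = m p"
proof -
  have "Bseq (\<lambda>n. LINT x|M n. x ^ 1)"
    using lim[of 1] by (intro convergent_imp_Bseq convergentI)
  then obtain C where C: "\<And>n. norm (LINT x|M n. x ^ 1) \<le> C" by (auto simp: Bseq_def)
  have "(LINT x|M n. x) \<le> C" for n
    using C[of n] by simp
  then have "tight M"
    using int[of _ 1] by (intro tight_of_bounded_first_moment rd nonneg) simp_all
  from tight_imp_convergent_subsubsequence[OF this strict_mono_id]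
  obtain r N where r: "strict_mono r" and N: "real_distribution N"
    and w: "weak_conv_m (\<lambda>n. M (r n)) N"
    by (auto simp: comp_def)
  interpret N: real_distribution N by (rule N)
  have conv: "(\<lambda>n. LINT x|M (r n). f x) \<longlonglongrightarrow> (LINT x|N. f x)"
    if "\<And>x. isCont f x" "\<And>x. norm (f x) \<le> B" for f :: "real \<Rightarrow> real" and B
    using weak_conv_imp_integral_bdd_continuous_conv[OF rd N w that] .
  have N0: "AE x in N. 0 \<le> x"
  proof -
    \<comment> \<open>A bounded continuous function vanishing exactly on the nonnegative half-line,
      so that weak convergence can detect mass on the negative one.\<close>
    define f where "f x = max 0 (min 1 (- x))" for x :: real
    have meas[measurable]: "f \<in> borel_measurable borel" unfolding f_def by measurable
    have "(LINT x|M (r n). f x) = 0" for n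
    proof -
      have "AE x in M (r n). f x = 0" using nonneg[of "r n"] by eventually_elim (auto simp: f_def)
      then show ?thesis by (rule integral_eq_zero_AE)
    qed
    moreover have "(\<lambda>n. LINT x|M (r n). f x) \<longlonglongrightarrow> (LINT x|N. f x)"
      by (rule conv[of _ 1]) (auto simp: f_def intro!: continuous_intros)
    ultimately have "(LINT x|N. f x) = 0" by (simp add: LIMSEQ_const_iff)
    moreover have "integrable N f"
      by (rule N.integrable_const_bound[of _ 1]) (auto simp: f_def)
    moreover have "AE x in N. 0 \<le> f x" by (auto simp: f_def)
    ultimately have "AE x in N. f x = 0"
      using integral_nonneg_eq_0_iff_AE by blast
    then show ?thesis by eventually_elim (auto simp: f_def max_def min_def split: if_splits)
  qed
  have mom: "integrable N (\<lambda>x. x ^ p) \<and> (LINT x|N. x ^ p) = m p" for p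
  proof -
    \<comment> \<open>The absolute value bounds odd powers from below on the negative half-line,
      which carries no mass anyway, and makes \<open>T R\<close> increasing in
      \<open>R\<close>.\<close>
    define T where "T R x = min (\<bar>x\<bar> ^ p) R" for R x :: real
    have meas[measurable]: "T R \<in> borel_measurable borel" for R unfolding T_def by measurable
    have bnd: "m p - m (2 * p) / R \<le> (LINT x|N. T R x) \<and> (LINT x|N. T R x) \<le> m p"
      if R: "R > 0" for R
    proof -
      have L: "(\<lambda>n. LINT x|M (r n). T R x) \<longlonglongrightarrow> (LINT x|N. T R x)"
        by (rule conv[of _ R]) (auto simp: T_def R less_imp_le intro!: continuous_intros)
      have limr: "(\<lambda>n. LINT x|M (r n). x ^ q) \<longlonglongrightarrow> m q" for q
        using LIMSEQ_subseq_LIMSEQ[OF lim r] by (simp add: comp_def)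
      have intT: "integrable (M n) (T R)" for n
      proof -
        interpret real_distribution "M n" by (rule rd)
        show ?thesis by (rule integrable_const_bound[of _ R]) (use R in \<open>auto simp: T_def\<close>)
      qed
      have up: "(LINT x|M n. T R x) \<le> (LINT x|M n. x ^ p)" for n
        using nonneg[of n] by (intro integral_mono_AE intT int) (auto simp: T_def)
      have lo: "(LINT x|M n. x ^ p) - (LINT x|M n. x ^ (2 * p)) / R \<le> (LINT x|M n. T R x)" for n
      proof -
        have "(LINT x|M n. x ^ p - x ^ (2 * p) / R) \<le> (LINT x|M n. T R x)"
        proof (rule integral_mono_AE)
          show "AE x in M n. x ^ p - x ^ (2 * p) / R \<le> T R x"
            using nonneg[of n]
          proof eventually_elim
            case (elim x)
            then show ?case
              using diff_min_le_square_div[of "x ^ p" R] R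
              by (simp add: T_def power_mult[symmetric] mult.commute)
          qed
        qed (intro intT int Bochner_Integration.integrable_diff integrable_divide)+
        then show ?thesis
          by (subst (asm) Bochner_Integration.integral_diff) (use int in auto)
      qed
      have "m p - m (2 * p) / R \<le> (LINT x|N. T R x)"
        by (rule LIMSEQ_le[OF tendsto_diff[OF limr tendsto_divide[OF limr tendsto_const]] L])
          (use lo R in auto)
      moreover have "(LINT x|N. T R x) \<le> m p"
        by (rule LIMSEQ_le[OF L limr]) (use up in auto)
      ultimately show ?thesis ..
    qed
    have intTN: "integrable N (T R)" if "R > 0" for R
      by (rule N.integrable_const_bound[of _ R]) (use that in \<open>auto simp: T_def\<close>)
    \<comment> \<open>Levels \<open>Suc k\<close> keep the truncation level positive, as
      \<open>bnd\<close> requires. Monotone convergence then yields integrability of the power and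
      its integral together.\<close>
    have Lm: "(\<lambda>k. LINT x|N. T (real (Suc k)) x) \<longlonglongrightarrow> m p"
    proof (rule tendsto_sandwich[of "\<lambda>k. m p - m (2 * p) / real (Suc k)" _ _ "\<lambda>_. m p"])
      have "(\<lambda>k. m p - m (2 * p) * inverse (real (Suc k))) \<longlonglongrightarrow> m p - m (2 * p) * 0"
        by (intro tendsto_intros LIMSEQ_inverse_real_of_nat)
      then show "(\<lambda>k. m p - m (2 * p) / real (Suc k)) \<longlonglongrightarrow> m p"
        by (simp add: divide_inverse)
    qed (use bnd in auto)
    have lims: "(\<lambda>k. T (real (Suc k)) x) \<longlonglongrightarrow> x ^ p" if "x \<ge> 0" for x
    proof (rule tendsto_eventually)
      obtain K where K: "x ^ p \<le> real K" using real_arch_simple by blast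
      show "\<forall>\<^sub>F k in sequentially. T (real (Suc k)) x = x ^ p"
        using eventually_ge_at_top[of K]
      proof eventually_elim
        case (elim k)
        then have "x ^ p \<le> real (Suc k)" using K by linarith
        then show ?case using that by (simp add: T_def)
      qed
    qed
    have mc1: "AE x in N. mono (\<lambda>k. T (real (Suc k)) x)"
      by (auto simp: T_def mono_def)
    have mc2: "AE x in N. (\<lambda>k. T (real (Suc k)) x) \<longlonglongrightarrow> x ^ p"
      using N0 by eventually_elim (rule lims)
    have mc3: "(\<lambda>x. x ^ p) \<in> borel_measurable N" by measurable
    note mc = _ mc1 mc2 Lm mc3
    show ?thesis
      using integrable_monotone_convergence[OF mc] integral_monotone_convergence[OF mc] intTN
      by simp
  qed
  show thesis using that[OF N N0] mom by blast
qed

section \<open>The Mittag-Leffler distribution\<close>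

text \<open>The rising factorial is a monic polynomial in \<open>k\<close>, and for
  \<open>k \<ge> 1\<close> all its lower powers are absorbed by the second highest one. Together
  with \<open>power_le_pochhammer\<close> this makes rising factorial moments and ordinary moments
  agree after scaling.\<close>

lemma pochhammer_Suc_le_power:
  "\<exists>C\<ge>0. \<forall>k::nat\<ge>1. pochhammer (real k) (Suc p) \<le> real k ^ Suc p + C * real k ^ p"
proof (induction p)
  case 0
  show ?case by (intro exI[of _ 0]) simp
next
  case (Suc p)
  then obtain C where C: "C \<ge> 0"
    and h: "\<And>k::nat. k \<ge> 1 \<Longrightarrow> pochhammer (real k) (Suc p) \<le> real k ^ Suc p + C * real k ^ p"
    by auto
  let ?D = "real (Suc p) + C + C * real (Suc p)"
  show ?case
  proof (intro exI[of _ ?D] conjI allI impI)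
    show "0 \<le> ?D" using C by simp
    fix k :: nat assume k: "1 \<le> k"
    have "pochhammer (real k) (Suc (Suc p)) = pochhammer (real k) (Suc p) * (real k + real (Suc p))"
      by (rule pochhammer_Suc)
    also have "\<dots> \<le> (real k ^ Suc p + C * real k ^ p) * (real k + real (Suc p))"
      by (intro mult_right_mono h k) auto
    also have "\<dots> = real k ^ Suc (Suc p) + (real (Suc p) + C) * real k ^ Suc p
        + C * real (Suc p) * real k ^ p"
      by (simp add: algebra_simps)
    also have "\<dots> \<le> real k ^ Suc (Suc p) + (real (Suc p) + C) * real k ^ Suc p
        + C * real (Suc p) * real k ^ Suc p"
      using C k by (intro add_left_mono mult_left_mono power_increasing) auto
    finally show "pochhammer (real k) (Suc (Suc p))
        \<le> real k ^ Suc (Suc p) + ?D * real k ^ Suc p"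
      by (simp add: algebra_simps)
  qed
qed

lemma power_le_pochhammer: "x \<ge> 0 \<Longrightarrow> x ^ p \<le> pochhammer (x::real) p"
proof (induction p)
  case (Suc p)
  have "x ^ p * x \<le> pochhammer x p * (x + real p)"
    using Suc by (intro mult_mono) (auto intro: order_trans[OF zero_le_power])
  then show ?case by (simp add: pochhammer_Suc mult.commute)
qed simp

text \<open>
  Number of occupied tables after \<open>n + 1\<close> customers in the Chinese restaurant process with
  parameters \<open>(\<alpha>, 0)\<close>.
\<close>

primrec table_count :: "real \<Rightarrow> nat \<Rightarrow> nat pmf" where
  "table_count \<alpha> 0 = return_pmf 1"
| "table_count \<alpha> (Suc n) = bind_pmf (table_count \<alpha> n) (\<lambda>k.
     map_pmf (\<lambda>b. if b then Suc k else k) (bernoulli_pmf (\<alpha> * real k / real (Suc n))))"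

lemma set_table_count: "set_pmf (table_count \<alpha> n) \<subseteq> {1..Suc n}"
proof (induction n)
  case (Suc n)
  then show ?case by (fastforce split: if_splits)
qed simp

lemma finite_table_count: "finite (set_pmf (table_count \<alpha> n))"
  using set_table_count finite_subset by blast

text \<open>The rising factorial is an eigenfunction of each transition: a step up with probability
  \<open>\<alpha> * k / (n + 1)\<close> multiplies its expectation by
  \<open>1 + \<alpha> * p / (n + 1)\<close>, independently of \<open>k\<close>. The product of these
  factors is the stated quotient.\<close>

lemma expectation_pochhammer_table_count:
  assumes "0 < \<alpha>" "\<alpha> \<le> 1"
  shows "measure_pmf.expectation (table_count \<alpha> n) (\<lambda>k. pochhammer (real k) p)
    = fact p * pochhammer (\<alpha> * real p + 1) n / fact n"
proof (induction n)
  case 0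
  show ?case by (simp add: pochhammer_fact)
next
  case (Suc n)
  let ?h = "\<lambda>k. pochhammer (real k) p"
  let ?c = "1 + \<alpha> * real p / real (Suc n)"
  have step: "measure_pmf.expectation (map_pmf (\<lambda>b. if b then Suc k else k)
      (bernoulli_pmf (\<alpha> * real k / real (Suc n)))) ?h = ?c * ?h k"
    if "k \<in> {1..Suc n}" for k
  proof -
    let ?q = "\<alpha> * real k / real (Suc n)"
    \<comment> \<open>Since \<open>k \<le> n + 1\<close>, the parameter is a genuine probability and
      \<open>bernoulli_pmf\<close> does not clamp it.\<close>
    have "\<alpha> * real k \<le> 1 * real (Suc n)" using that assms by (intro mult_mono) auto
    then have q: "0 \<le> ?q" "?q \<le> 1" using assms by (auto simp: field_simps)
    \<comment> \<open>Both sides are the rising factorial of length \<open>p + 1\<close>, with the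
      first or the last factor split off.\<close>
    have poch: "real k * pochhammer (real k + 1) p = (real k + real p) * ?h k"
      using pochhammer_rec[of "real k" p] pochhammer_Suc[of "real k" p] by (simp add: mult.commute)
    have "measure_pmf.expectation (map_pmf (\<lambda>b. if b then Suc k else k) (bernoulli_pmf ?q)) ?h
        = ?q * pochhammer (real k + 1) p + (1 - ?q) * ?h k"
      using q by (simp add: integral_bernoulli_pmf add.commute)
    also have "\<dots> = (\<alpha> / real (Suc n)) * (real k * pochhammer (real k + 1) p) + (1 - ?q) * ?h k"
      by simp
    also have "\<dots> = ?c * ?h k"
      unfolding poch by (simp add: diff_divide_distrib add_divide_distrib algebra_simps del: of_nat_Suc)
    finally show ?thesis .
  qed
  have "measure_pmf.expectation (table_count \<alpha> (Suc n)) ?h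
      = (\<Sum>k\<in>{1..Suc n}. pmf (table_count \<alpha> n) k *\<^sub>R (?c * ?h k))"
    unfolding table_count.simps
    by (subst pmf_expectation_bind[OF _ _ set_table_count])
      (auto simp: step simp del: of_nat_Suc sum.cl_ivl_Suc integral_map_pmf intro!: sum.cong)
  also have "\<dots> = ?c * (\<Sum>k\<in>{1..Suc n}. pmf (table_count \<alpha> n) k *\<^sub>R ?h k)"
    unfolding sum_distrib_left by (intro sum.cong refl) simp
  also have "(\<Sum>k\<in>{1..Suc n}. pmf (table_count \<alpha> n) k *\<^sub>R ?h k)
      = measure_pmf.expectation (table_count \<alpha> n) ?h"
    using set_table_count[of \<alpha> n] by (intro integral_measure_pmf[symmetric]) auto
  also have "?c * \<dots> = fact p * pochhammer (\<alpha> * real p + 1) (Suc n) / fact (Suc n)"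
  proof -
    have "?c = (\<alpha> * real p + 1 + real n) / real (Suc n)" by (simp add: field_simps)
    then show ?thesis unfolding Suc.IH by (simp add: pochhammer_Suc mult.commute)
  qed
  finally show ?case .
qed

text \<open>Euler's limit for the reciprocal Gamma function. The product in
  \<open>rGamma_series x n\<close> starts at \<open>x\<close>, so dividing by \<open>x\<close>
  leaves the one starting at \<open>x + 1\<close>; hence the separate case
  \<open>x = 0\<close>.\<close>

lemma pochhammer_over_fact_asymptotic:
  assumes "x \<ge> (0::real)"
  shows "(\<lambda>n. pochhammer (x + 1) n / fact n * real n powr (- x)) \<longlonglongrightarrow> 1 / Gamma (x + 1)"
proof (cases "x = 0")
  case True
  have "\<forall>\<^sub>F n in sequentially. pochhammer (x + 1) n / fact n * real n powr (- x) = 1"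
    using eventually_gt_at_top[of 0] by eventually_elim (simp add: True pochhammer_fact[symmetric])
  then show ?thesis using True by (simp add: tendsto_eventually)
next
  case False
  then have x: "x > 0" using assms by simp
  have "\<forall>\<^sub>F n in sequentially.
      rGamma_series x n / x = pochhammer (x + 1) n / fact n * real n powr (- x)"
    using eventually_gt_at_top[of 0]
    by eventually_elim
      (use x in \<open>simp add: rGamma_series_def pochhammer_rec powr_def exp_minus field_simps\<close>)
  moreover have "(\<lambda>n. rGamma_series x n / x) \<longlonglongrightarrow> rGamma x / x"
    by (intro tendsto_intros) (use x in auto)
  moreover have "rGamma x / x = 1 / Gamma (x + 1)"
    using x Gamma_plus1[of x] nonpos_Ints_nonpos[of x]
    by (force simp: rGamma_inverse_Gamma field_simps)
  ultimately show ?thesis using Lim_transform_eventually by fastforce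
qed

text \<open>The power moment is squeezed between the rising factorial moment of the same order and
  that moment minus a lower-order correction.\<close>

lemma scaled_table_count_moments:
  assumes "0 < \<alpha>" "\<alpha> \<le> 1"
  shows "(\<lambda>n. measure_pmf.expectation (table_count \<alpha> n)
      (\<lambda>k. (real k * real n powr (- \<alpha>)) ^ p)) \<longlonglongrightarrow> fact p / Gamma (\<alpha> * real p + 1)"
proof -
  let ?E = "\<lambda>n. measure_pmf.expectation (table_count \<alpha> n)"
  let ?s = "\<lambda>n::nat. real n powr (- \<alpha>)"
  note int[simp] = integrable_measure_pmf_finite[OF finite_table_count]
  have pw: "?s n ^ q = real n powr (- (\<alpha> * real q))" if "n > 0" for n q
    using that by (simp add: powr_realpow[symmetric] powr_powr)
  have s0: "?s \<longlonglongrightarrow> 0"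
    using assms by (intro tendsto_neg_powr filterlim_real_sequentially) auto
  have poch: "(\<lambda>n. ?E n (\<lambda>k. pochhammer (real k) q) * ?s n ^ q)
      \<longlonglongrightarrow> fact q / Gamma (\<alpha> * real q + 1)" for q
  proof -
    have "(\<lambda>n. fact q * (pochhammer (\<alpha> * real q + 1) n / fact n * real n powr (- (\<alpha> * real q))))
        \<longlonglongrightarrow> fact q * (1 / Gamma (\<alpha> * real q + 1))"
      using assms by (intro tendsto_intros pochhammer_over_fact_asymptotic) auto
    moreover have "\<forall>\<^sub>F n in sequentially.
        fact q * (pochhammer (\<alpha> * real q + 1) n / fact n * real n powr (- (\<alpha> * real q)))
        = ?E n (\<lambda>k. pochhammer (real k) q) * ?s n ^ q"
      using eventually_gt_at_top[of 0]
      by eventually_elim (simp add: expectation_pochhammer_table_count[OF assms] pw)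
    ultimately show ?thesis using Lim_transform_eventually by fastforce
  qed
  show ?thesis
  proof (cases p)
    case 0
    then show ?thesis by simp
  next
    case (Suc q)
    obtain C where C: "C \<ge> 0"
      and h: "\<And>k::nat. k \<ge> 1 \<Longrightarrow> pochhammer (real k) (Suc q) \<le> real k ^ Suc q + C * real k ^ q"
      using pochhammer_Suc_le_power[of q] by auto
    let ?a = "\<lambda>q n. ?E n (\<lambda>k. pochhammer (real k) q)"
    have up: "?E n (\<lambda>k. (real k * ?s n) ^ p) \<le> ?a p n * ?s n ^ p" for n
    proof -
      have "?E n (\<lambda>k. (real k * ?s n) ^ p) \<le> ?E n (\<lambda>k. pochhammer (real k) p * ?s n ^ p)"
        by (intro integral_mono) (auto simp: power_mult_distrib intro!: mult_right_mono power_le_pochhammer)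
      then show ?thesis by simp
    qed
    \<comment> \<open>The moment of order \<open>q = p - 1\<close> needs only \<open>q\<close> of
      the \<open>p\<close> scaling factors; the spare factor \<open>?s n\<close> drives the
      correction to 0.\<close>
    have lo: "?a p n * ?s n ^ p - C * ?s n * (?a q n * ?s n ^ q) \<le> ?E n (\<lambda>k. (real k * ?s n) ^ p)" for n
    proof -
      have "?E n (\<lambda>k. pochhammer (real k) p * ?s n ^ p - C * ?s n * (pochhammer (real k) q * ?s n ^ q))
          \<le> ?E n (\<lambda>k. (real k * ?s n) ^ p)"
      proof (rule integral_mono_AE)
        show "AE k in table_count \<alpha> n. pochhammer (real k) p * ?s n ^ p
            - C * ?s n * (pochhammer (real k) q * ?s n ^ q) \<le> (real k * ?s n) ^ p"
        proof (rule AE_pmfI)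
          fix k assume "k \<in> set_pmf (table_count \<alpha> n)"
          then have k: "k \<ge> 1" using set_table_count[of \<alpha> n] by auto
          have "pochhammer (real k) p \<le> real k ^ p + C * pochhammer (real k) q"
            using h[OF k] power_le_pochhammer[of "real k" q] C Suc
            by (smt (verit, best) mult_left_mono of_nat_0_le_iff)
          then have "pochhammer (real k) p * ?s n ^ p
              \<le> (real k ^ p + C * pochhammer (real k) q) * ?s n ^ p"
            by (intro mult_right_mono) auto
          then show "pochhammer (real k) p * ?s n ^ p
            - C * ?s n * (pochhammer (real k) q * ?s n ^ q) \<le> (real k * ?s n) ^ p"
            by (simp add: Suc power_mult_distrib algebra_simps)
        qed
      qed auto
      then show ?thesis by simp
    qed
    have "(\<lambda>n. ?a p n * ?s n ^ p - C * ?s n * (?a q n * ?s n ^ q))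
        \<longlonglongrightarrow> fact p / Gamma (\<alpha> * real p + 1) - C * 0 * (fact q / Gamma (\<alpha> * real q + 1))"
      by (intro tendsto_intros poch s0)
    then have "(\<lambda>n. ?a p n * ?s n ^ p - C * ?s n * (?a q n * ?s n ^ q))
        \<longlonglongrightarrow> fact p / Gamma (\<alpha> * real p + 1)"
      by simp
    from tendsto_sandwich[OF _ _ this poch[of p]] show ?thesis
      using lo up by (simp only: eventually_True)
  qed
qed

text \<open>Log-convexity of Gamma at \<open>x + 1\<close>, a convex combination of
  \<open>x + \<alpha>\<close> and \<open>x + \<alpha> + 1\<close>, combined with the functional
  equation at \<open>x\<close> and at \<open>x + \<alpha>\<close>. The resulting lower bound for the
  ratio \<open>Gamma (x + \<alpha>) / Gamma x\<close> grows like the power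
  \<open>x powr \<alpha>\<close>.\<close>

lemma Gamma_add_ge:
  fixes x \<alpha> :: real
  assumes "x > 0" "0 < \<alpha>" "\<alpha> \<le> 1"
  shows "x * (x + \<alpha>) powr (\<alpha> - 1) * Gamma x \<le> Gamma (x + \<alpha>)"
proof -
  let ?L = "\<lambda>y. ln (Gamma y) :: real"
  have "?L (\<alpha> * (x + \<alpha>) + (1 - \<alpha>) * (x + \<alpha> + 1)) \<le> \<alpha> * ?L (x + \<alpha>) + (1 - \<alpha>) * ?L (x + \<alpha> + 1)"
    using convex_onD[OF log_convex_Gamma_real, of "1 - \<alpha>" "x + \<alpha>" "x + \<alpha> + 1"] assms
    by simp
  moreover have "\<alpha> * (x + \<alpha>) + (1 - \<alpha>) * (x + \<alpha> + 1) = x + 1" by (simp add: algebra_simps)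
  moreover have "?L (x + \<alpha> + 1) = ln (x + \<alpha>) + ?L (x + \<alpha>)"
    using assms Gamma_plus1[of "x + \<alpha>"] nonpos_Ints_nonpos[of "x + \<alpha>"]
      Gamma_real_pos[of "x + \<alpha>"]
    by (subst ln_mult_pos[symmetric]) auto
  moreover have "?L (x + 1) = ln x + ?L x"
    using assms Gamma_plus1[of x] nonpos_Ints_nonpos[of x] Gamma_real_pos[of x]
    by (subst ln_mult_pos[symmetric]) auto
  ultimately have "ln x + ?L x + (\<alpha> - 1) * ln (x + \<alpha>) \<le> ?L (x + \<alpha>)"
    by (simp add: algebra_simps)
  then have "exp (ln x + ?L x + (\<alpha> - 1) * ln (x + \<alpha>)) \<le> exp (?L (x + \<alpha>))" by simp
  then show ?thesis
    using assms by (simp add: exp_add powr_def mult_ac)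
qed

lemma summable_mittag_leffler:
  fixes r :: real
  assumes "0 < \<alpha>" "\<alpha> \<le> 1" "0 \<le> r"
  shows "summable (\<lambda>n. r ^ n / Gamma (\<alpha> * real n + 1))"
proof -
  \<comment> \<open>The lower bound from \<open>Gamma_add_ge\<close> for the ratio of consecutive
    Gamma values, taken at \<open>\<alpha> * n + 1\<close>.\<close>
  define q where "q n = (\<alpha> * real n + 1) * (\<alpha> * real n + 1 + \<alpha>) powr (\<alpha> - 1)" for n
  have "filterlim q at_top sequentially"
    unfolding q_def using assms by real_asymp
  \<comment> \<open>The term \<open>2 * r\<close> gives the ratio 1/2; the extra 1 ensures
    \<open>q n > 0\<close> even for \<open>r = 0\<close>.\<close>
  then have "\<forall>\<^sub>F n in sequentially. 2 * r + 1 \<le> q n" by (simp add: filterlim_at_top)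
  then obtain K where K: "\<And>n. n \<ge> K \<Longrightarrow> 2 * r + 1 \<le> q n" by (auto simp: eventually_sequentially)
  show ?thesis
  proof (rule summable_ratio_test[of "1/2" K])
    fix n assume "n \<ge> K"
    then have q: "2 * r \<le> q n" "0 < q n" using K[of n] assms by auto
    let ?G = "Gamma (\<alpha> * real n + 1)"
    have g: "?G > 0" using assms by (intro Gamma_real_pos) (simp add: add_nonneg_pos)
    have "q n * ?G \<le> Gamma (\<alpha> * real (Suc n) + 1)"
    proof -
      have "0 < \<alpha> * real n + 1" using assms by (simp add: add_nonneg_pos)
      from Gamma_add_ge[OF this assms(1,2)] show ?thesis
        by (simp add: q_def algebra_simps)
    qed
    then have "r ^ Suc n / Gamma (\<alpha> * real (Suc n) + 1) \<le> r ^ Suc n / (q n * ?G)"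
      using q g assms by (intro divide_left_mono mult_pos_pos) (auto intro!: Gamma_real_pos add_nonneg_pos)
    also have "\<dots> = (r / q n) * (r ^ n / ?G)" by simp
    also have "\<dots> \<le> 1/2 * (r ^ n / ?G)"
      using q g assms by (intro mult_right_mono) (auto simp: field_simps)
    finally show "norm (r ^ Suc n / Gamma (\<alpha> * real (Suc n) + 1)) \<le> 1/2 * norm (r ^ n / ?G)"
      using assms g by (simp add: add_nonneg_pos abs_mult del: of_nat_Suc)
  qed simp
qed

text \<open>The factorials in the limiting moments cancel those of the exponential series.
  Integrating termwise is legitimate for every complex \<open>z\<close>: absolute moments equal
  moments on the half-line, so absolute convergence is that of the Mittag-Leffler series at
  \<open>norm z\<close>.\<close>

lemma mittag_leffler_distribution:
  assumes "0 < \<alpha>" "\<alpha> \<le> 1"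
  obtains N where "real_distribution N" "AE x in N. 0 \<le> x"
    "\<And>z. (LINT x|N. exp (z * complex_of_real x)) = mittag_leffler \<alpha> z"
proof -
  \<comment> \<open>Because \<open>0 powr (- \<alpha>) = 0\<close>, the law \<open>M 0\<close> is
    the point mass at 0, which does not affect the limit.\<close>
  define M where "M n = distr (table_count \<alpha> n) borel (\<lambda>k. real k * real n powr (- \<alpha>))" for n
  have M_rd: "real_distribution (M n)" for n
    unfolding M_def by (intro prob_space.real_distribution_distr measure_pmf.prob_space_axioms) simp
  have M_nonneg: "AE x in M n. 0 \<le> x" for n
    unfolding M_def by (subst AE_distr_iff) auto
  have M_int: "integrable (M n) (\<lambda>x. x ^ p)" for n p
    unfolding M_def
    by (subst integrable_distr_eq) (auto intro: integrable_measure_pmf_finite finite_table_count)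
  have M_lim: "(\<lambda>n. LINT x|M n. x ^ p) \<longlonglongrightarrow> fact p / Gamma (\<alpha> * real p + 1)" for p
    unfolding M_def by (subst integral_distr) (auto intro: scaled_table_count_moments assms)
  from stieltjes_moments_limit[OF M_rd M_nonneg M_int M_lim]
  obtain N where N: "real_distribution N" "AE x in N. 0 \<le> x"
    and int: "\<And>p. integrable N (\<lambda>x. x ^ p)"
    and mom: "\<And>p. (LINT x|N. x ^ p) = fact p / Gamma (\<alpha> * real p + 1)"
    by metis
  interpret real_distribution N by (rule N)
  have "(LINT x|N. exp (z * complex_of_real x)) = mittag_leffler \<alpha> z" for z
  proof -
    let ?f = "\<lambda>p x. (z ^ p / fact p) * complex_of_real (x ^ p)"
    have ex: "exp (z * complex_of_real x) = (\<Sum>p. ?f p x)" for x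
      by (simp add: exp_def power_mult_distrib scaleR_conv_of_real divide_inverse mult_ac)
    have nf: "norm (?f p x) = norm z ^ p / fact p * \<bar>x\<bar> ^ p" for p x
      by (simp add: norm_mult norm_divide norm_power)
    have ii: "integrable N (?f p)" for p
      by (intro integrable_mult_right integrable_of_real int)
    have abs: "(LINT x|N. \<bar>x\<bar> ^ p) = fact p / Gamma (\<alpha> * real p + 1)" for p
      unfolding mom[symmetric] by (intro integral_cong_AE) (use N(2) in auto)
    have "(LINT x|N. (\<Sum>p. ?f p x)) = (\<Sum>p. LINT x|N. ?f p x)"
    proof (rule integral_suminf[OF ii])
      show "AE x in N. summable (\<lambda>p. norm (?f p x))"
        unfolding nf using summable_exp[of "norm z * \<bar>x\<bar>" for x]
        by (simp add: power_mult_distrib divide_inverse mult_ac)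
      show "summable (\<lambda>p. LINT x|N. norm (?f p x))"
        unfolding nf using summable_mittag_leffler[OF assms, of "norm z"] by (simp add: abs)
    qed
    also have "\<dots> = mittag_leffler \<alpha> z"
      unfolding mittag_leffler_def using mom
      by (intro suminf_cong) (simp add: integral_complex_of_real del: of_real_power)
    finally show ?thesis by (simp only: ex)
  qed
  then show thesis using that N by blast
qed

section \<open>Test functions\<close>

lemma has_derivative_scaled_add:
  fixes f h :: "'a::real_normed_vector \<Rightarrow> 'b::real_normed_vector"
  assumes "f differentiable (at x)" "h differentiable (at x)"
  shows "((\<lambda>y. a *\<^sub>R f y + b *\<^sub>R h y) has_derivative
    (\<lambda>v. a *\<^sub>R frechet_derivative f (at x) v + b *\<^sub>R frechet_derivative h (at x) v)) (at x)"
  using assms by (intro has_derivative_add has_derivative_scaleR_right)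
    (simp_all add: frechet_derivative_works[symmetric])

text \<open>Induction over the directions with \<open>x\<close> arbitrary in the open set
  \<open>S\<close>: one further derivative at \<open>x\<close> requires the identity on a
  neighbourhood of \<open>x\<close>.\<close>

lemma iter_partial_scaled_add:
  fixes f h :: "'e::euclidean_space \<Rightarrow> 'f::real_normed_vector"
  assumes S: "open S" and f: "smooth_on S f" and h: "smooth_on S h"
    and bs: "bs \<in> lists Basis" and x: "x \<in> S"
  shows "iter_partial bs (\<lambda>y. a *\<^sub>R f y + b *\<^sub>R h y) x
    = a *\<^sub>R iter_partial bs f x + b *\<^sub>R iter_partial bs h x"
  using bs x
proof (induction bs arbitrary: x rule: list.induct)
  case (Cons v bs)
  have bs': "bs \<in> lists Basis" using Cons.prems(1) by simp
  let ?g = "\<lambda>y. a *\<^sub>R f y + b *\<^sub>R h y"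
  have D: "((\<lambda>y. a *\<^sub>R iter_partial bs f y + b *\<^sub>R iter_partial bs h y) has_derivative
    (\<lambda>v. a *\<^sub>R frechet_derivative (iter_partial bs f) (at x) v
      + b *\<^sub>R frechet_derivative (iter_partial bs h) (at x) v)) (at x)"
    using bs' Cons.prems(2) f h by (intro has_derivative_scaled_add) (auto simp: smooth_on_def)
  have "(iter_partial bs ?g has_derivative
    (\<lambda>v. a *\<^sub>R frechet_derivative (iter_partial bs f) (at x) v
      + b *\<^sub>R frechet_derivative (iter_partial bs h) (at x) v)) (at x)"
    by (rule has_derivative_transform_within_open[OF D S Cons.prems(2)])
      (simp add: Cons.IH[OF bs'])
  from frechet_derivative_at[OF this, symmetric] show ?case
    by (simp add: partial_deriv_def)
qed simp

lemma smooth_on_scaled_add: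
  fixes f h :: "'e::euclidean_space \<Rightarrow> 'f::real_normed_vector"
  assumes S: "open S" and f: "smooth_on S f" and h: "smooth_on S h"
  shows "smooth_on S (\<lambda>y. a *\<^sub>R f y + b *\<^sub>R h y)"
  unfolding smooth_on_def
proof (intro ballI)
  fix bs :: "'e list" and x
  assume bs: "bs \<in> lists Basis" and x: "x \<in> S"
  have D: "((\<lambda>y. a *\<^sub>R iter_partial bs f y + b *\<^sub>R iter_partial bs h y) has_derivative
    (\<lambda>v. a *\<^sub>R frechet_derivative (iter_partial bs f) (at x) v
      + b *\<^sub>R frechet_derivative (iter_partial bs h) (at x) v)) (at x)"
    using bs x f h by (intro has_derivative_scaled_add) (auto simp: smooth_on_def)
  show "iter_partial bs (\<lambda>y. a *\<^sub>R f y + b *\<^sub>R h y) differentiable at x"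
    by (rule differentiableI, rule has_derivative_transform_within_open[OF D S x])
      (use iter_partial_scaled_add[OF S f h bs] in auto)
qed

text \<open>Sum, difference and scaling all specialize this combination. Its support is a closed
  subset of the union of two compact supports.\<close>

lemma test_functions_scaled_add:
  fixes A :: "('m::t2_space, 'n::finite) chart set"
  assumes A: "smooth_atlas A" and f: "f \<in> test_functions A" and h: "h \<in> test_functions A"
  shows "(\<lambda>x. a * f x + b * h x) \<in> test_functions A"
proof -
  have "smooth_on (snd c ` fst c) ((\<lambda>x. a * f x + b * h x) \<circ> chart_inv c)" if c: "c \<in> A" for c
  proof -
    have "open (snd c ` fst c)" using A c by (auto simp: smooth_atlas_def is_chart_def)
    from smooth_on_scaled_add[OF this, of "f \<circ> chart_inv c" "h \<circ> chart_inv c" a b] f h c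
    show ?thesis by (simp add: test_functions_def comp_def)
  qed
  moreover have "compact (closure {x. a * f x + b * h x \<noteq> 0})"
  proof -
    have "closure {x. a * f x + b * h x \<noteq> 0} \<subseteq> closure {x. f x \<noteq> 0} \<union> closure {x. h x \<noteq> 0}"
      unfolding closure_Un[symmetric] by (intro closure_mono) auto
    then have "(closure {x. f x \<noteq> 0} \<union> closure {x. h x \<noteq> 0}) \<inter> closure {x. a * f x + b * h x \<noteq> 0}
        = closure {x. a * f x + b * h x \<noteq> 0}" by blast
    moreover have "compact (closure {x. f x \<noteq> 0} \<union> closure {x. h x \<noteq> 0})"
      using f h by (intro compact_Un) (auto simp: test_functions_def)
    then have "compact ((closure {x. f x \<noteq> 0} \<union> closure {x. h x \<noteq> 0})
        \<inter> closure {x. a * f x + b * h x \<noteq> 0})"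
      by (rule compact_Int_closed) (rule closed_closure)
    ultimately show ?thesis by (simp only:)
  qed
  ultimately show ?thesis by (simp add: test_functions_def)
qed

lemma test_functions_add:
  assumes "smooth_atlas A" "f \<in> test_functions A" "h \<in> test_functions A"
  shows "(\<lambda>x. f x + h x) \<in> test_functions (A :: ('m::t2_space, 'n::finite) chart set)"
  using test_functions_scaled_add[OF assms, of 1 1] by simp

lemma test_functions_diff:
  assumes "smooth_atlas A" "f \<in> test_functions A" "h \<in> test_functions A"
  shows "(\<lambda>x. f x - h x) \<in> test_functions (A :: ('m::t2_space, 'n::finite) chart set)"
  using test_functions_scaled_add[OF assms, of 1 "-1"] by simp

lemma test_functions_scale:
  assumes "smooth_atlas A" "f \<in> test_functions A"
  shows "(\<lambda>x. r * f x) \<in> test_functions (A :: ('m::t2_space, 'n::finite) chart set)"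
  using test_functions_scaled_add[OF assms assms(2), of r 0] by simp

section \<open>Topology of the manifold through its charts\<close>

lemma atlas_covers:
  assumes "smooth_atlas A"
  obtains c where "c \<in> A" "p \<in> fst c" "is_chart c"
  using assms unfolding smooth_atlas_def by blast

lemma chart_inv_chart: "is_chart c \<Longrightarrow> x \<in> fst c \<Longrightarrow> chart_inv c (snd c x) = x"
  by (auto simp: is_chart_def homeomorphism_def)

text \<open>Smoothness for the empty list of directions gives differentiability, hence continuity,
  in each chart; continuity is local. It provides Borel measurability later.\<close>

lemma test_function_continuous:
  assumes A: "smooth_atlas A" and f: "f \<in> test_functions A"
  shows "continuous_on UNIV f"
proof -
  have "continuous_on (\<Union>c\<in>A. fst c) f"
  proof (rule continuous_on_open_UN)
    fix c assume c: "c \<in> A"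
    then have ch: "is_chart c" using A by (simp add: smooth_atlas_def)
    then show "open (fst c)" by (simp add: is_chart_def)
    have "smooth_on (snd c ` fst c) (f \<circ> chart_inv c)" using f c by (simp add: test_functions_def)
    then have "\<And>x. x \<in> snd c ` fst c \<Longrightarrow> (f \<circ> chart_inv c) differentiable (at x)"
      unfolding smooth_on_def by (metis iter_partial.simps(1) lists.Nil)
    then have "continuous_on (snd c ` fst c) (f \<circ> chart_inv c)"
      by (intro continuous_at_imp_continuous_on) (blast intro: differentiable_imp_continuous_within)
    moreover have "continuous_on (fst c) (snd c)"
      using ch by (auto simp: is_chart_def homeomorphism_def)
    ultimately have "continuous_on (fst c) ((f \<circ> chart_inv c) \<circ> snd c)"
      by (rule continuous_on_compose[rotated])
    then show "continuous_on (fst c) f"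
      by (rule continuous_on_eq) (simp add: chart_inv_chart[OF ch])
  qed
  then show ?thesis using A by (simp add: smooth_atlas_def)
qed

lemma atlas_locally_compact:
  fixes A :: "('m::t2_space, 'n::finite) chart set" and p :: 'm
  assumes "smooth_atlas A"
  obtains V K where "open V" "p \<in> V" "V \<subseteq> K" "compact K"
proof -
  obtain c where "c \<in> A" and c: "p \<in> fst c" "is_chart c"
    by (rule atlas_covers[OF assms, of p])
  let ?S = "snd c ` fst c"
  have hom: "homeomorphism ?S (fst c) (chart_inv c) (snd c)"
    using c homeomorphism_sym by (auto simp: is_chart_def)
  have op: "open ?S" "open (fst c)" using c by (auto simp: is_chart_def)
  obtain e where e: "e > 0" "cball (snd c p) e \<subseteq> ?S"
    using op(1) c(1) open_contains_cball by blast
  show thesis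
  proof
    have "openin (top_of_set ?S) (ball (snd c p) e)"
      using e ball_subset_cball by (intro open_subset) blast+
    from homeomorphism_imp_open_map[OF hom this]
    show "open (chart_inv c ` ball (snd c p) e)" using op(2) by (simp add: openin_open_eq)
    show "p \<in> chart_inv c ` ball (snd c p) e"
      using e(1) chart_inv_chart[OF c(2,1)] by (metis centre_in_ball image_eqI)
    show "chart_inv c ` ball (snd c p) e \<subseteq> chart_inv c ` cball (snd c p) e"
      by (intro image_mono ball_subset_cball)
    show "compact (chart_inv c ` cball (snd c p) e)"
      using hom e(2) by (intro compact_continuous_image compact_cball)
        (auto simp: homeomorphism_def intro: continuous_on_subset)
  qed
qed

text \<open>Take a countable cover by relatively compact open sets and make it disjoint. A compact
  set lies in finitely many members of the cover, and every piece with a larger index avoids these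
  members.\<close>

lemma locally_finite_partition:
  fixes A :: "('m::{second_countable_topology, t2_space}, 'n::finite) chart set"
  assumes A: "smooth_atlas A"
  obtains B :: "nat \<Rightarrow> 'm set" where "\<And>k. B k \<in> sets borel" "disjoint_family B"
    "(\<Union>k. B k) = UNIV" "\<And>k. \<exists>K. compact K \<and> B k \<subseteq> K"
    "\<And>K. compact K \<Longrightarrow> finite {k. B k \<inter> K \<noteq> {}}"
proof -
  define F where "F = {V :: 'm set. open V \<and> (\<exists>K. compact K \<and> V \<subseteq> K)}"
  obtain F' where F': "F' \<subseteq> F" "countable F'" "\<Union>F' = \<Union>F"
    using Lindelof[of F] by (auto simp: F_def)
  have "\<Union>F = UNIV"
    using atlas_locally_compact[OF A] unfolding F_def by (metis (mono_tags, lifting) UNIV_eq_I UnionI mem_Collect_eq)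
  then have cov: "\<Union>F' = UNIV" using F' by simp
  then have ne: "F' \<noteq> {}" by auto
  define V where "V = from_nat_into F'"
  have rV: "range V = F'" unfolding V_def by (rule range_from_nat_into[OF ne F'(2)])
  have V: "open (V k)" "\<exists>K. compact K \<and> V k \<subseteq> K" for k
    using F'(1) rV by (auto simp: F_def)
  show thesis
  proof
    show "disjointed V k \<in> sets borel" for k
      using V(1) by (auto simp: disjointed_def intro!: sets.Diff sets.countable_UN')
    show "disjoint_family (disjointed V)" by (rule disjoint_family_disjointed)
    show "(\<Union>k. disjointed V k) = UNIV" by (simp add: UN_disjointed_eq rV cov)
    show "\<exists>K. compact K \<and> disjointed V k \<subseteq> K" for k
      using V(2)[of k] disjointed_subset[of V k] by blast
    fix K :: "'m set" assume "compact K"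
    moreover have "K \<subseteq> \<Union> (range V)" by (simp add: rV cov)
    ultimately obtain C where C: "finite C" "K \<subseteq> (\<Union>k\<in>C. V k)"
      using V(1) by (metis compactE_image)
    \<comment> \<open>Inserting 0 keeps \<open>Max\<close> meaningful when \<open>C\<close> is
      empty.\<close>
    then have fin: "finite {..Max (insert 0 C)}" by simp
    have "{k. disjointed V k \<inter> K \<noteq> {}} \<subseteq> {..Max (insert 0 C)}"
    proof
      fix k assume "k \<in> {k. disjointed V k \<inter> K \<noteq> {}}"
      then obtain x where x: "x \<in> disjointed V k" "x \<in> K" by auto
      then obtain j where j: "j \<in> C" "x \<in> V j" using C by auto
      then have "k \<le> j" using x(1) by (auto simp: disjointed_def not_less[symmetric])
      also have "j \<le> Max (insert 0 C)" using C j by (intro Max_ge) auto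
      finally show "k \<in> {..Max (insert 0 C)}" by simp
    qed
    then show "finite {k. disjointed V k \<inter> K \<noteq> {}}" using fin finite_subset by blast
  qed
qed

section \<open>Locally finite point configurations as distributions\<close>

text \<open>Being 1-Lipschitz for a single member \<open>p\<close> of the family suffices. Members
  of \<open>P\<close> are arbitrary functions here, so \<open>p (\<lambda>_. 0) = 0\<close> is what
  places the centre inside its own ball.\<close>

lemma continuous_map_seminorm_topology:
  assumes p: "p \<in> P" "p (\<lambda>_. 0) = 0"
    and lip: "\<And>f h. f \<in> V \<Longrightarrow> h \<in> V \<Longrightarrow> \<bar>q h - q f\<bar> \<le> p (\<lambda>x. h x - f x)"
  shows "continuous_map (seminorm_topology V P) euclideanreal q"
  unfolding continuous_map_def
proof (intro conjI allI impI)
  show "q \<in> topspace (seminorm_topology V P) \<rightarrow> topspace euclideanreal" by simp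
  have top: "topspace (seminorm_topology V P) \<subseteq> V" by (auto simp: seminorm_topology_def)
  fix U assume "openin euclideanreal U"
  then have U: "open U" by simp
  show "openin (seminorm_topology V P) {f \<in> topspace (seminorm_topology V P). q f \<in> U}"
  proof (subst openin_subopen, intro ballI)
    fix f assume f: "f \<in> {f \<in> topspace (seminorm_topology V P). q f \<in> U}"
    then have fV: "f \<in> V" using top by auto
    obtain e where e: "e > 0" "\<And>y. \<bar>y - q f\<bar> < e \<Longrightarrow> y \<in> U"
      using U f by (auto simp: open_dist dist_real_def)
    let ?T = "{h \<in> V. p (\<lambda>x. h x - f x) < e}"
    have T: "openin (seminorm_topology V P) ?T"
      unfolding seminorm_topology_def
      by (rule topology_generated_by_Basis) (use p(1) fV e(1) in blast)
    moreover have "f \<in> ?T" using p(2) e(1) fV by simp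
    moreover have "?T \<subseteq> {f \<in> topspace (seminorm_topology V P). q f \<in> U}"
      using openin_subset[OF T] e(2) lip[OF fV] by (force intro: le_less_trans)
    ultimately show "\<exists>T. openin (seminorm_topology V P) T \<and> f \<in> T
        \<and> T \<subseteq> {f \<in> topspace (seminorm_topology V P). q f \<in> U}" by blast
  qed
qed

text \<open>For the compact set \<open>{x}\<close> and no derivatives, \<open>deriv_seminorm\<close>
  is the absolute value of the evaluation at \<open>x\<close>.\<close>

lemma continuous_map_evaluation:
  fixes A :: "('m::topological_space, 'n::finite) chart set"
  assumes A: "smooth_atlas A"
  shows "continuous_map (frechet_topology A K) euclideanreal (\<lambda>f. f x)"
proof -
  obtain c where c: "c \<in> A" "x \<in> fst c" "is_chart c" by (rule atlas_covers[OF A])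
  have v: "deriv_seminorm c {x} [] f = \<bar>f x\<bar>" for f
    by (simp add: deriv_seminorm_def chart_inv_chart c)
  have "deriv_seminorm c {x} [] \<in> {deriv_seminorm c L bs | c L bs.
       c \<in> A \<and> compact L \<and> L \<noteq> {} \<and> L \<subseteq> fst c \<and> bs \<in> lists Basis}"
    using c by (intro CollectI exI[of _ c] exI[of _ "{x}"] exI[of _ "[]"]) auto
  then show ?thesis
    unfolding frechet_topology_def by (rule continuous_map_seminorm_topology) (simp_all add: v)
qed

text \<open>
  Points \<open>x k j\<close> outside \<open>B k\<close> are discarded, so that local finiteness holds for every choice
  of \<open>x\<close> and not just almost surely.
\<close>

definition configuration_sum ::
    "(nat \<Rightarrow> 'm set) \<Rightarrow> (nat \<Rightarrow> nat) \<Rightarrow> (nat \<Rightarrow> nat \<Rightarrow> 'm) \<Rightarrow> ('m \<Rightarrow> real) \<Rightarrow> real"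
  where "configuration_sum B n x f = (\<Sum>k. \<Sum>j<n k. indicator (B k) (x k j) * f (x k j))"

lemma configuration_sum_finite:
  assumes "finite F" "\<And>k. k \<notin> F \<Longrightarrow> B k \<inter> {x. f x \<noteq> 0} = {}"
  shows "configuration_sum B n x f = (\<Sum>k\<in>F. \<Sum>j<n k. indicator (B k) (x k j) * f (x k j))"
  unfolding configuration_sum_def
proof (rule suminf_finite[OF assms(1)])
  fix k assume "k \<notin> F"
  then have "B k \<inter> {x. f x \<noteq> 0} = {}" by (rule assms(2))
  then show "(\<Sum>j<n k. indicator (B k) (x k j) * f (x k j)) = 0"
    by (intro sum.neutral) (auto simp: indicator_def)
qed

text \<open>The absolute value of the sum is itself one of the seminorms generating
  \<open>test_topology\<close>: on functions supported in \<open>K\<close> it is a finite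
  combination of evaluations. The functional is 1-Lipschitz for it.\<close>

lemma configuration_sum_in_distributions:
  fixes A :: "('m::t2_space, 'n::finite) chart set"
  assumes A: "smooth_atlas A"
    and fin: "\<And>K. compact K \<Longrightarrow> finite {k. B k \<inter> K \<noteq> {}}"
  shows "restrict (configuration_sum B n x) (test_functions A) \<in> distributions A"
proof -
  let ?T = "test_functions A" and ?w = "configuration_sum B n x"
  let ?s = "\<lambda>F f. \<Sum>k\<in>F. \<Sum>j<n k. indicator (B k) (x k j) * f (x k j)"
  have wK: "?w f = ?s {k. B k \<inter> K \<noteq> {}} f"
    if "compact K" "{x. f x \<noteq> 0} \<subseteq> K" for f K
    using that by (intro configuration_sum_finite fin) auto
  have supp: "compact (closure {x. f x \<noteq> 0})" if "f \<in> ?T" for f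
    using that by (simp add: test_functions_def)
  have add: "?w (\<lambda>x. f x + h x) = ?w f + ?w h" if f: "f \<in> ?T" and h: "h \<in> ?T" for f h
  proof -
    \<comment> \<open>A common compact set lets \<open>f\<close>, \<open>h\<close> and their sum be
      summed over the same finite set of blocks.\<close>
    let ?K = "closure {x. f x \<noteq> 0} \<union> closure {x. h x \<noteq> 0}"
    have K: "compact ?K" using f h by (intro compact_Un supp)
    have K1: "{x. f x \<noteq> 0} \<subseteq> ?K" "{x. h x \<noteq> 0} \<subseteq> ?K"
      by (simp_all add: closure_subset le_supI1 le_supI2)
    have "{x. f x + h x \<noteq> 0} \<subseteq> {x. f x \<noteq> 0} \<union> {x. h x \<noteq> 0}" by auto
    also have "\<dots> \<subseteq> ?K" using K1 by simp
    finally have K2: "{x. f x + h x \<noteq> 0} \<subseteq> ?K" .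
    show ?thesis by (simp add: wK[OF K K1(1)] wK[OF K K1(2)] wK[OF K K2] distrib_left sum.distrib)
  qed
  have scale: "?w (\<lambda>x. r * f x) = r * ?w f" if f: "f \<in> ?T" for f r
  proof -
    let ?K = "closure {x. f x \<noteq> 0}"
    have "{x. r * f x \<noteq> 0} \<subseteq> ?K" "{x. f x \<noteq> 0} \<subseteq> ?K"
      using closure_subset[of "{x. f x \<noteq> 0}"] by auto
    from wK[OF supp[OF f] this(1)] wK[OF supp[OF f] this(2)]
    show ?thesis by (simp add: sum_distrib_left mult_ac del: sum_mult_indicator sum_indicator_mult)
  qed
  have diff: "?w (\<lambda>x. h x - f x) = ?w h - ?w f" if "f \<in> ?T" "h \<in> ?T" for f h
    using add[OF test_functions_diff[OF A that(2,1)] that(1)] by simp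
  let ?P = "{p. seminorm_on ?T p \<and>
        (\<forall>K. compact K \<longrightarrow> continuous_map (frechet_topology A K) euclideanreal p)}"
  have "(\<lambda>f. \<bar>?w f\<bar>) \<in> ?P"
  proof (intro CollectI conjI allI impI)
    show "seminorm_on ?T (\<lambda>f. \<bar>?w f\<bar>)"
      by (auto simp: seminorm_on_def add scale abs_mult)
    fix K :: "'m set" assume K: "compact K"
    have "continuous_map (frechet_topology A K) euclideanreal (\<lambda>f. \<bar>?s {k. B k \<inter> K \<noteq> {}} f\<bar>)"
      by (intro continuous_map_real_abs continuous_map_sum fin[OF K] finite_lessThan
          continuous_map_real_mult continuous_map_canonical_const continuous_map_evaluation[OF A])
    then show "continuous_map (frechet_topology A K) euclideanreal (\<lambda>f. \<bar>?w f\<bar>)"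
    proof (rule continuous_map_eq)
      fix f assume "f \<in> topspace (frechet_topology A K)"
      then have "closure {x. f x \<noteq> 0} \<subseteq> K"
        by (auto simp: frechet_topology_def seminorm_topology_def test_functions_on_def)
      then have "{x. f x \<noteq> 0} \<subseteq> K" by (rule order_trans[OF closure_subset])
      then show "\<bar>?s {k. B k \<inter> K \<noteq> {}} f\<bar> = \<bar>?w f\<bar>" by (simp add: wK[OF K])
    qed
  qed
  moreover have "\<bar>?w (\<lambda>_. 0)\<bar> = 0" by (simp add: configuration_sum_def)
  ultimately have "continuous_map (test_topology A) euclideanreal (restrict ?w ?T)"
    unfolding test_topology_def by (rule continuous_map_seminorm_topology) (simp add: diff)
  then show ?thesis
    using test_functions_add[OF A] test_functions_scale[OF A]
    by (simp add: distributions_def add scale)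
qed

section \<open>Poisson point processes\<close>

definition poisson_weight :: "real \<Rightarrow> nat \<Rightarrow> real"
  where "poisson_weight r n = r ^ n / fact n * exp (- r)"

lemma poisson_weight_nonneg: "r \<ge> 0 \<Longrightarrow> poisson_weight r n \<ge> 0"
  by (simp add: poisson_weight_def)

lemma poisson_weight_sums: "poisson_weight r sums 1"
proof -
  have "(\<lambda>n. r ^ n /\<^sub>R fact n) sums exp r" by (rule exp_converges)
  from sums_mult2[OF this, of "exp (- r)"]
  have "(\<lambda>n. r ^ n /\<^sub>R fact n * exp (- r)) sums 1" by (simp add: exp_minus_inverse)
  moreover have "r ^ n /\<^sub>R fact n * exp (- r) = poisson_weight r n" for n
    by (simp add: poisson_weight_def divide_inverse mult.commute)
  ultimately show ?thesis by simp
qed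

text \<open>Inverse transform sampling of the Poisson law. Joint measurability in \<open>r\<close>
  and \<open>u\<close> allows a random rate. For \<open>r \<ge> 0\<close> and
  \<open>u \<ge> 1\<close> no index qualifies, but \<open>unit_uniform\<close> gives such
  \<open>u\<close> no mass.\<close>

definition poisson_quantile :: "real \<Rightarrow> real \<Rightarrow> nat"
  where "poisson_quantile r u = (LEAST n. u < (\<Sum>i<Suc n. poisson_weight r i))"

lemma poisson_quantile_measurable[measurable]:
  assumes [measurable]: "f \<in> borel_measurable M" "g \<in> borel_measurable M"
  shows "(\<lambda>x. poisson_quantile (f x) (g x)) \<in> M \<rightarrow>\<^sub>M count_space UNIV"
  unfolding poisson_quantile_def poisson_weight_def by measurable

text \<open>The partial sums of the weights increase to 1, so they cut the unit interval into one
  cell for each value.\<close>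

lemma poisson_quantile_eq_iff:
  assumes r: "r \<ge> 0" and u: "0 \<le> u" "u < 1"
  shows "poisson_quantile r u = n \<longleftrightarrow>
    u \<in> {(\<Sum>i<n. poisson_weight r i)..<(\<Sum>i<Suc n. poisson_weight r i)}"
proof -
  let ?c = "\<lambda>n. \<Sum>i<n. poisson_weight r i"
  have mono: "?c k \<le> ?c l" if "k \<le> l" for k l
    using that r by (intro sum_mono2) (auto simp: poisson_weight_nonneg)
  have "?c \<longlonglongrightarrow> 1" using poisson_weight_sums[of r] by (simp add: sums_def)
  then have "\<forall>\<^sub>F n in sequentially. u < ?c n" using u(2) by (rule order_tendstoD)
  then obtain k where "\<And>n. n \<ge> k \<Longrightarrow> u < ?c n" by (auto simp: eventually_sequentially)
  then have ex: "u < ?c (Suc k)" using le_Suc_eq by blast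
  have L: "u < ?c (Suc (poisson_quantile r u))"
    unfolding poisson_quantile_def using ex by (rule LeastI)
  have lower: "?c (poisson_quantile r u) \<le> u"
  proof (cases "poisson_quantile r u")
    case 0
    then show ?thesis using u by simp
  next
    case (Suc l)
    then have "\<not> u < ?c (Suc l)"
      using not_less_Least[of l "\<lambda>n. u < ?c (Suc n)"] by (simp add: poisson_quantile_def)
    then show ?thesis using Suc by simp
  qed
  show ?thesis
  proof
    assume "poisson_quantile r u = n"
    then show "u \<in> {?c n..<?c (Suc n)}" using L lower by auto
  next
    assume n: "u \<in> {?c n..<?c (Suc n)}"
    show "poisson_quantile r u = n"
    proof (rule antisym)
      show "poisson_quantile r u \<le> n" unfolding poisson_quantile_def using n by (intro Least_le) simp
      show "n \<le> poisson_quantile r u"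
        using n L mono[of "Suc (poisson_quantile r u)" n] by (auto simp: not_less_eq_eq[symmetric] simp del: sum.lessThan_Suc)
    qed
  qed
qed

abbreviation unit_uniform :: "real measure"
  where "unit_uniform \<equiv> uniform_measure lborel {0..<1}"

lemma prob_space_unit_uniform: "prob_space unit_uniform"
  by (rule prob_space_uniform_measure) auto

lemma emeasure_poisson_quantile:
  assumes r: "r \<ge> 0"
  shows "emeasure unit_uniform {u. poisson_quantile r u = n} = ennreal (poisson_weight r n)"
proof -
  let ?c = "\<lambda>n. \<Sum>i<n. poisson_weight r i"
  have "?c (Suc n) \<le> (\<Sum>i. poisson_weight r i)"
    using poisson_weight_sums r by (intro sum_le_suminf) (auto simp: poisson_weight_nonneg sums_iff)
  then have c1: "?c (Suc n) \<le> 1" using poisson_weight_sums[of r] by (simp add: sums_iff)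
  have c0: "0 \<le> ?c n" using r by (intro sum_nonneg) (auto simp: poisson_weight_nonneg)
  have "{0..<1} \<inter> {u. poisson_quantile r u = n} = {?c n..<?c (Suc n)}"
  proof (rule set_eqI)
    fix u
    show "u \<in> {0..<1} \<inter> {u. poisson_quantile r u = n} \<longleftrightarrow> u \<in> {?c n..<?c (Suc n)}"
    proof (cases "0 \<le> u \<and> u < 1")
      case True
      then show ?thesis using poisson_quantile_eq_iff[OF r, of u n] by simp
    next
      case False
      then show ?thesis using c0 c1 by (auto simp del: sum.lessThan_Suc)
    qed
  qed
  moreover have "{u. poisson_quantile r u = n} \<in> sets lborel"
    using poisson_quantile_measurable[of "\<lambda>_. r" lborel "\<lambda>u. u"] by measurable
  ultimately show ?thesis
    using r by (simp add: poisson_weight_nonneg divide_ennreal_def)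
qed

text \<open>The Poisson generating function at \<open>c\<close>; the bound on \<open>norm c\<close>
  makes the series absolutely convergent.\<close>

lemma integral_power_poisson_quantile:
  fixes c :: complex
  assumes r: "r \<ge> 0" and c: "norm c \<le> 1"
  shows "(LINT u|unit_uniform. c ^ poisson_quantile r u) = exp (of_real r * (c - 1))"
proof -
  have [measurable]: "poisson_quantile r \<in> unit_uniform \<rightarrow>\<^sub>M count_space UNIV"
    using poisson_quantile_measurable[of "\<lambda>_. r" unit_uniform "\<lambda>u. u"] by simp
  have D: "distr unit_uniform (count_space UNIV) (poisson_quantile r)
      = density (count_space UNIV) (\<lambda>n. ennreal (poisson_weight r n))"
  proof (rule measure_eqI_countable[of _ UNIV])
    fix n :: nat
    show "emeasure (distr unit_uniform (count_space UNIV) (poisson_quantile r)) {n}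
        = emeasure (density (count_space UNIV) (\<lambda>n. ennreal (poisson_weight r n))) {n}"
      using emeasure_poisson_quantile[OF r, of n]
      by (simp add: emeasure_distr emeasure_density vimage_def)
  qed auto
  have le: "norm (poisson_weight r n *\<^sub>R c ^ n) \<le> poisson_weight r n" for n
    using c r by (auto simp: norm_power poisson_weight_nonneg intro!: mult_left_le power_le_one)
  have "summable (\<lambda>n. norm (poisson_weight r n *\<^sub>R c ^ n))"
    by (rule summable_comparison_test'[OF sums_summable[OF poisson_weight_sums[of r]]]) (use le in auto)
  then have int: "integrable (count_space UNIV) (\<lambda>n. poisson_weight r n *\<^sub>R c ^ n)"
    by (simp add: integrable_count_space_nat_iff)
  have "(LINT u|unit_uniform. c ^ poisson_quantile r u)
      = (LINT n|distr unit_uniform (count_space UNIV) (poisson_quantile r). c ^ n)"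
    by (subst integral_distr) auto
  also have "\<dots> = (\<Sum>n. poisson_weight r n *\<^sub>R c ^ n)"
    unfolding D using r int
    by (subst integral_density) (auto simp: poisson_weight_nonneg integral_count_space_nat)
  also have "\<dots> = exp (of_real r * c) * of_real (exp (- r))"
  proof (rule sums_unique[symmetric])
    have "(\<lambda>n. (of_real r * c) ^ n /\<^sub>R fact n) sums exp (of_real r * c)" by (rule exp_converges)
    from sums_mult2[OF this, of "of_real (exp (- r))"]
    show "(\<lambda>n. poisson_weight r n *\<^sub>R c ^ n) sums (exp (of_real r * c) * of_real (exp (- r)))"
      by (simp add: poisson_weight_def scaleR_conv_of_real power_mult_distrib divide_inverse mult_ac)
  qed
  also have "\<dots> = exp (of_real r * (c - 1))"
    by (simp add: exp_of_real[symmetric] exp_add[symmetric] right_diff_distrib)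
  finally show ?thesis .
qed

text \<open>Independence of finitely many coordinates in a possibly infinite product, by passing to
  the finite marginal.\<close>

lemma (in product_prob_space) integral_PiM_prod:
  fixes f :: "'i \<Rightarrow> 'a \<Rightarrow> 'b::{real_normed_field, banach, second_countable_topology}"
  assumes J: "finite J" "J \<subseteq> I" and f: "\<And>j. j \<in> J \<Longrightarrow> integrable (M j) (f j)"
  shows "(LINT x|PiM I M. (\<Prod>j\<in>J. f j (x j))) = (\<Prod>j\<in>J. LINT y|M j. f j y)"
proof -
  have m: "(\<lambda>x. \<Prod>j\<in>J. f j (x j)) \<in> borel_measurable (PiM J M)"
    using f by (intro borel_measurable_prod measurable_compose[OF measurable_component_singleton]
        borel_measurable_integrable)
  have "(\<Prod>j\<in>J. LINT y|M j. f j y) = (LINT x|PiM J M. (\<Prod>j\<in>J. f j (x j)))"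
    by (rule product_integral_prod[symmetric, OF J(1) f])
  also have "\<dots> = (LINT x|distr (PiM I M) (PiM J M) (\<lambda>x. restrict x J). (\<Prod>j\<in>J. f j (x j)))"
    by (simp add: distr_PiM_restrict_finite[OF J])
  also have "\<dots> = (LINT x|PiM I M. (\<Prod>j\<in>J. f j (restrict x J j)))"
    by (rule integral_distr[OF measurable_restrict_subset[OF J(2)] m])
  also have "\<dots> = (LINT x|PiM I M. (\<Prod>j\<in>J. f j (x j)))"
    by (intro Bochner_Integration.integral_cong prod.cong) auto
  finally show ?thesis ..
qed

text \<open>One uniform variable, from which the number of points is read off, and the points.\<close>

definition block_space :: "'a measure \<Rightarrow> (real \<times> (nat \<Rightarrow> 'a)) measure"
  where "block_space N = unit_uniform \<Otimes>\<^sub>M PiM UNIV (\<lambda>_. N)"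

lemma prob_space_block_space:
  assumes "prob_space N"
  shows "prob_space (block_space N)"
proof -
  interpret N: prob_space N by fact
  interpret P: product_prob_space "\<lambda>_::nat. N" UNIV ..
  interpret U: prob_space unit_uniform by (rule prob_space_unit_uniform)
  interpret pair_prob_space unit_uniform "PiM (UNIV::nat set) (\<lambda>_. N)" ..
  show ?thesis unfolding block_space_def by (rule prob_space_axioms)
qed

text \<open>The number of points takes countably many values, so it may be frozen. Both the rate and
  the block may depend on the sample point, which covers a fixed as well as a random
  intensity.\<close>

lemma block_sum_measurable:
  fixes \<psi> :: "'a \<Rightarrow> real"
  assumes [measurable]: "\<psi> \<in> borel_measurable N"
    and [measurable]: "r \<in> borel_measurable M" "q \<in> M \<rightarrow>\<^sub>M block_space N"
  shows "(\<lambda>x. \<Sum>j<poisson_quantile (r x) (fst (q x)). \<psi> (snd (q x) j)) \<in> borel_measurable M"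
proof -
  have q2: "(\<lambda>x. fst (q x)) \<in> M \<rightarrow>\<^sub>M unit_uniform" "(\<lambda>x. snd (q x)) \<in> M \<rightarrow>\<^sub>M PiM UNIV (\<lambda>_. N)"
    using assms(3) unfolding block_space_def by measurable
  have [measurable]: "(\<lambda>x. snd (q x) j) \<in> M \<rightarrow>\<^sub>M N" for j
    using measurable_compose[OF q2(2) measurable_component_singleton[of j UNIV "\<lambda>_. N"]] by simp
  have [measurable]: "(\<lambda>x. fst (q x)) \<in> borel_measurable M"
    using q2(1) by (simp cong: measurable_cong_sets)
  show ?thesis
    by (rule measurable_compose_countable[where f = "\<lambda>n x. \<Sum>j<n. \<psi> (snd (q x) j)"]) measurable
qed

text \<open>A compound Poisson sum: given the number of points, independence yields a power of the
  characteristic function \<open>c\<close> of one summand, and the Poisson generating function at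
  \<open>c\<close> averages these powers.\<close>

lemma block_characteristic_function:
  fixes \<psi> :: "'a \<Rightarrow> real"
  assumes N: "prob_space N" and \<psi>[measurable]: "\<psi> \<in> borel_measurable N" and r: "r \<ge> 0"
  shows "(LINT q|block_space N.
      exp (\<i> * of_real (\<Sum>j<poisson_quantile r (fst q). \<psi> (snd q j))))
    = exp (of_real r * (LINT x|N. exp (\<i> * of_real (\<psi> x)) - 1))"
proof -
  interpret N: prob_space N by fact
  interpret P: product_prob_space "\<lambda>_::nat. N" UNIV ..
  interpret U: prob_space unit_uniform by (rule prob_space_unit_uniform)
  interpret UP: pair_prob_space unit_uniform "PiM (UNIV::nat set) (\<lambda>_. N)" ..
  interpret B: prob_space "block_space N" by (rule prob_space_block_space[OF N])
  let ?e = "\<lambda>x. exp (\<i> * complex_of_real (\<psi> x))"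
  let ?F = "\<lambda>q. exp (\<i> * complex_of_real (\<Sum>j<poisson_quantile r (fst q). \<psi> (snd q j)))"
  define c where "c = (LINT x|N. ?e x)"
  have inte: "integrable N ?e" by (rule N.integrable_const_bound[of _ 1]) auto
  have "norm c \<le> (LINT x|N. norm (?e x))" unfolding c_def by (rule integral_norm_bound)
  then have c: "norm c \<le> 1" by (simp add: N.prob_space)
  have "(\<lambda>q. \<Sum>j<poisson_quantile r (fst q). \<psi> (snd q j)) \<in> borel_measurable (block_space N)"
    by (rule block_sum_measurable[of \<psi> N "\<lambda>_. r" "block_space N" "\<lambda>q. q"]) auto
  then have "?F \<in> borel_measurable (block_space N)" by measurable
  then have "integrable (block_space N) ?F"
    by (intro B.integrable_const_bound[of _ 1]) (auto simp del: of_real_sum)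
  then have "(LINT q|block_space N. ?F q)
      = (LINT u|unit_uniform. LINT x|PiM UNIV (\<lambda>_. N). ?F (u, x))"
    unfolding block_space_def by (rule UP.integral_fst'[symmetric])
  also have "\<dots> = (LINT u|unit_uniform. c ^ poisson_quantile r u)"
  proof (rule Bochner_Integration.integral_cong[OF refl])
    fix u
    have "(LINT x|PiM UNIV (\<lambda>_. N). ?F (u, x))
        = (LINT x|PiM UNIV (\<lambda>_. N). (\<Prod>j<poisson_quantile r u. ?e (x j)))"
      by (simp add: exp_sum sum_distrib_left)
    also have "\<dots> = c ^ poisson_quantile r u"
      by (subst P.integral_PiM_prod) (auto simp: inte c_def)
    finally show "(LINT x|PiM UNIV (\<lambda>_. N). ?F (u, x)) = c ^ poisson_quantile r u" .
  qed
  also have "\<dots> = exp (of_real r * (c - 1))"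
    by (rule integral_power_poisson_quantile[OF r c])
  also have "c - 1 = (LINT x|N. ?e x - 1)"
    using inte by (simp add: c_def N.prob_space)
  finally show ?thesis .
qed

text \<open>Multiplying by the mass, rather than dividing by it, lets the identity include a null
  set \<open>B\<close>: there any probability measure serves, and a Dirac measure is taken.\<close>

lemma normalized_restriction:
  fixes \<mu> :: "'a measure"
  assumes B: "B \<in> sets \<mu>" and fin: "emeasure \<mu> B < \<infinity>" and ne: "space \<mu> \<noteq> {}"
  obtains N where "prob_space N" "sets N = sets \<mu>"
    "\<And>h :: 'a \<Rightarrow> complex. h \<in> borel_measurable \<mu> \<Longrightarrow>
      of_real (measure \<mu> B) * (LINT x|N. h x) = (LINT x|\<mu>. indicator B x *\<^sub>R h x)"
proof (cases "emeasure \<mu> B = 0")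
  case True
  obtain a where "a \<in> space \<mu>" using ne by blast
  then have "prob_space (return \<mu> a)" by (rule prob_space_return)
  moreover have "(LINT x|\<mu>. indicator B x *\<^sub>R h x) = 0" for h :: "'a \<Rightarrow> complex"
  proof (rule integral_eq_zero_AE)
    have "AE x in \<mu>. x \<notin> B" using True B by (intro AE_not_in) (auto simp: null_sets_def)
    then show "AE x in \<mu>. indicator B x *\<^sub>R h x = 0" by eventually_elim simp
  qed
  ultimately show thesis using that[of "return \<mu> a"] True by (simp add: measure_def)
next
  case False
  define m where "m = measure \<mu> B"
  have em: "emeasure \<mu> B = ennreal m" using fin by (simp add: m_def emeasure_eq_ennreal_measure)
  then have m: "m > 0" using False by (metis ennreal_eq_0_iff not_le)
  have U: "uniform_measure \<mu> B = density \<mu> (\<lambda>x. ennreal (indicator B x / m))"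
    unfolding uniform_measure_def em
    by (intro density_cong) (use B m in \<open>auto simp: indicator_def divide_ennreal ennreal_1[symmetric] simp del: ennreal_1\<close>)
  show thesis
  proof (rule that)
    show "prob_space (uniform_measure \<mu> B)" using False fin by (intro prob_space_uniform_measure) auto
    show "sets (uniform_measure \<mu> B) = sets \<mu>" by simp
    fix h :: "'a \<Rightarrow> complex" assume h[measurable]: "h \<in> borel_measurable \<mu>"
    note B[measurable]
    have "(LINT x|uniform_measure \<mu> B. h x) = (LINT x|\<mu>. (indicator B x / m) *\<^sub>R h x)"
      unfolding U by (rule integral_density) (use m in auto)
    also have "\<dots> = (LINT x|\<mu>. (1 / m) *\<^sub>R (indicator B x *\<^sub>R h x))" by simp
    also have "\<dots> = (1 / m) *\<^sub>R (LINT x|\<mu>. indicator B x *\<^sub>R h x)"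
      by (rule integral_scaleR_right)
    finally show "of_real (measure \<mu> B) * (LINT x|uniform_measure \<mu> B. h x)
        = (LINT x|\<mu>. indicator B x *\<^sub>R h x)"
      using m by (simp add: m_def[symmetric] scaleR_conv_of_real)
  qed
qed

section \<open>The mixed Poisson measure\<close>

lemma cylinder_sets_Pow: "cylinder_sets A \<subseteq> Pow (distributions A)"
  by (auto simp: cylinder_sets_def)

lemma space_cylinder_algebra: "space (cylinder_algebra A) = distributions A"
  unfolding cylinder_algebra_def by (rule space_measure_of[OF cylinder_sets_Pow])

text \<open>A cylinder set is the preimage of a Borel set under a finite vector of pairings, so
  single pairings suffice as tests.\<close>

lemma measurable_cylinder_algebraI:
  assumes T: "\<And>x. x \<in> space M \<Longrightarrow> T x \<in> distributions A"
    and m: "\<And>\<phi>. \<phi> \<in> test_functions A \<Longrightarrow> (\<lambda>x. T x \<phi>) \<in> borel_measurable M"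
  shows "T \<in> M \<rightarrow>\<^sub>M cylinder_algebra A"
  unfolding cylinder_algebra_def
proof (rule measurable_measure_of[OF cylinder_sets_Pow])
  show "T \<in> space M \<rightarrow> distributions A" using T by auto
  fix Y assume "Y \<in> cylinder_sets A"
  then obtain N :: nat and \<phi> B where Y: "Y = {\<omega> \<in> distributions A. (\<lambda>i\<in>{..<N}. \<omega> (\<phi> i)) \<in> B}"
    and \<phi>: "\<phi> \<in> {..<N} \<rightarrow> test_functions A" and B: "B \<in> sets (Pi\<^sub>M {..<N} (\<lambda>_. borel))"
    by (auto simp: cylinder_sets_def)
  have "(\<lambda>x. \<lambda>i\<in>{..<N}. T x (\<phi> i)) \<in> M \<rightarrow>\<^sub>M Pi\<^sub>M {..<N} (\<lambda>_. borel)"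
    using \<phi> by (intro measurable_restrict m) auto
  from measurable_sets[OF this B]
  show "T -` Y \<inter> space M \<in> sets M"
    by (rule back_subst[of "\<lambda>X. X \<in> sets M"]) (auto simp: Y T)
qed

lemma evaluation_measurable:
  assumes "\<phi> \<in> test_functions A"
  shows "(\<lambda>\<omega>. \<omega> \<phi>) \<in> borel_measurable (cylinder_algebra A)"
proof (rule measurableI)
  fix B :: "real set" assume B: "B \<in> sets borel"
  let ?P = "Pi\<^sub>M {..<1::nat} (\<lambda>_. borel :: real measure)"
  let ?B = "(\<lambda>f. f 0) -` B \<inter> space ?P"
  have "?B \<in> sets ?P"
    by (rule measurable_sets[OF _ B]) (rule measurable_component_singleton, simp)
  then have "{\<omega> \<in> distributions A. (\<lambda>i\<in>{..<1::nat}. \<omega> ((\<lambda>_. \<phi>) i)) \<in> ?B} \<in> cylinder_sets A"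
    unfolding cylinder_sets_def using assms
    by (intro CollectI exI[of _ "1::nat"] exI[of _ "\<lambda>_. \<phi>"] exI[of _ ?B]) auto
  moreover have "{\<omega> \<in> distributions A. (\<lambda>i\<in>{..<1::nat}. \<omega> ((\<lambda>_. \<phi>) i)) \<in> ?B}
      = (\<lambda>\<omega>. \<omega> \<phi>) -` B \<inter> space (cylinder_algebra A)"
    by (auto simp: space_cylinder_algebra space_PiM)
  ultimately show "(\<lambda>\<omega>. \<omega> \<phi>) -` B \<inter> space (cylinder_algebra A) \<in> sets (cylinder_algebra A)"
    using sets_measure_of[OF cylinder_sets_Pow, of A] by (simp add: cylinder_algebra_def sigma_sets.Basic)
qed simp

theorem theorem1:
  fixes A :: "('m::{second_countable_topology, t2_space}, 'n::finite) chart set"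
    and g :: "('m, 'n) chart \<Rightarrow> 'm \<Rightarrow> real ^ 'n ^ 'n"
    and \<mu> :: "'m measure"
    and \<alpha> :: real
  assumes "oriented_smooth_atlas A"
    and "riemannian_metric A g"
    and "geodesically_complete A g"
    and "connected (UNIV :: 'm set)"
    and "\<not> compact (UNIV :: 'm set)"
    and "radon_measure \<mu>"
    and "non_atomic \<mu>"
    and "\<And>U. open U \<Longrightarrow> U \<noteq> {} \<Longrightarrow> emeasure \<mu> U > 0"
    and "emeasure \<mu> UNIV = \<infinity>"
    and "0 < \<alpha>" and "\<alpha> \<le> 1"
  shows "\<exists>\<pi>. prob_space \<pi> \<and>
           space \<pi> = distributions A \<and> sets \<pi> = sets (cylinder_algebra A) \<and>
           (\<forall>\<phi>\<in>test_functions A. characteristic_functional \<pi> \<phi> = C_functional \<alpha> \<mu> \<phi>)"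
proof -
  have A: "smooth_atlas A" using assms(1) by (simp add: oriented_smooth_atlas_def)
  have sets_\<mu>[simp, measurable_cong]: "sets \<mu> = sets borel"
    and finK: "\<And>K. compact K \<Longrightarrow> emeasure \<mu> K < \<infinity>"
    using assms(6) by (auto simp: radon_measure_def)
  have space_\<mu>: "space \<mu> = UNIV" using sets_eq_imp_space_eq[OF sets_\<mu>] by simp
  obtain B :: "nat \<Rightarrow> 'm set" where B[measurable]: "\<And>k. B k \<in> sets borel"
    and disj: "disjoint_family B" and cov: "(\<Union>k. B k) = UNIV"
    and BK: "\<And>k. \<exists>K. compact K \<and> B k \<subseteq> K"
    and locfin: "\<And>K. compact K \<Longrightarrow> finite {k. B k \<inter> K \<noteq> {}}"
    using locally_finite_partition[OF A] by metis
  have finB: "emeasure \<mu> (B k) < \<infinity>" for k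
  proof -
    obtain K where K: "compact K" "B k \<subseteq> K" using BK by blast
    then have "emeasure \<mu> (B k) \<le> emeasure \<mu> K"
      by (intro emeasure_mono) (auto intro: borel_compact)
    then show ?thesis using finK[OF K(1)] by (rule le_less_trans)
  qed
  have "\<exists>N. prob_space N \<and> sets N = sets \<mu> \<and> (\<forall>h :: 'm \<Rightarrow> complex. h \<in> borel_measurable \<mu> \<longrightarrow>
      of_real (measure \<mu> (B k)) * (LINT x|N. h x) = (LINT x|\<mu>. indicator (B k) x *\<^sub>R h x))" for k
    using normalized_restriction[of "B k" \<mu>] finB[of k] B[of k] space_\<mu>
    by (metis UNIV_not_empty sets_\<mu>)
  \<comment> \<open>\<open>N k\<close> will be the law of a single point of block
    \<open>k\<close>.\<close>
  then obtain N where N: "\<And>k. prob_space (N k)" and sets_N': "\<And>k. sets (N k) = sets \<mu>"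
    and int_N: "\<And>k (h :: 'm \<Rightarrow> complex). h \<in> borel_measurable \<mu> \<Longrightarrow>
      of_real (measure \<mu> (B k)) * (LINT x|N k. h x) = (LINT x|\<mu>. indicator (B k) x *\<^sub>R h x)"
    by metis
  have sets_N[simp, measurable_cong]: "sets (N k) = sets borel" for k using sets_N' by simp
  obtain L where L: "real_distribution L" and L_nonneg: "AE x in L. 0 \<le> x"
    and L_exp: "\<And>z. (LINT x|L. exp (z * complex_of_real x)) = mittag_leffler \<alpha> z"
    using mittag_leffler_distribution[OF assms(10,11)] by blast
  interpret L: real_distribution L by (rule L)
  interpret P: product_prob_space "\<lambda>k. block_space (N k)" "UNIV :: nat set"
    using prob_space_block_space[OF N]
    by (simp add: product_prob_space_def product_prob_space_axioms_def product_sigma_finite_def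
        prob_space_imp_sigma_finite)
  let ?P = "PiM (UNIV :: nat set) (\<lambda>k. block_space (N k))"
  interpret \<Omega>: pair_prob_space L ?P ..
  let ?\<Omega> = "L \<Otimes>\<^sub>M ?P"
  let ?m = "\<lambda>k. measure \<mu> (B k)"
  \<comment> \<open>The first coordinate of \<open>w\<close> is the random intensity, shared by all
    blocks. Conditionally on it, the blocks are independent, and block \<open>k\<close> has a
    Poisson number of points with mean \<open>fst w * ?m k\<close>.\<close>
  define T where "T w = restrict (configuration_sum B
      (\<lambda>k. poisson_quantile (fst w * ?m k) (fst (snd w k))) (\<lambda>k. snd (snd w k)))
      (test_functions A)" for w :: "real \<times> (nat \<Rightarrow> real \<times> (nat \<Rightarrow> 'm))"
  \<comment> \<open>The indicator moves the discarding of stray points into the test function, so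
    that \<open>S\<close> is a block sum of the form treated above.\<close>
  define \<psi> where "\<psi> \<phi> k x = indicator (B k) x * \<phi> x" for \<phi> :: "'m \<Rightarrow> real" and k x
  define S where "S \<phi> k r q = (\<Sum>j<poisson_quantile (r * ?m k) (fst q). \<psi> \<phi> k (snd q j))"
    for \<phi> :: "'m \<Rightarrow> real" and k r and q :: "real \<times> (nat \<Rightarrow> 'm)"
  have test_meas[measurable]: "\<phi> \<in> borel_measurable borel" if "\<phi> \<in> test_functions A" for \<phi>
    using test_function_continuous[OF A that] by (rule borel_measurable_continuous_onI)
  have \<psi>_meas: "\<psi> \<phi> k \<in> borel_measurable borel" if "\<phi> \<in> test_functions A" for \<phi> k
    using test_meas[OF that] unfolding \<psi>_def by measurable
  \<comment> \<open>The blocks seen by \<phi>, finitely many by compactness of the support; all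
    infinite sums and products reduce to \<open>F \<phi>\<close>.\<close>
  define F where "F \<phi> = {k. B k \<inter> closure {x. \<phi> x \<noteq> (0::real)} \<noteq> {}}" for \<phi>
  have finF: "finite (F \<phi>)" if "\<phi> \<in> test_functions A" for \<phi>
    using that unfolding F_def by (intro locfin) (simp add: test_functions_def)
  have offF: "B k \<inter> {x. \<phi> x \<noteq> 0} = {}" if "k \<notin> F \<phi>" for k \<phi>
    using that closure_subset[of "{x. \<phi> x \<noteq> 0}"] by (auto simp: F_def)
  have T_eq: "T w \<phi> = (\<Sum>k\<in>F \<phi>. S \<phi> k (fst w) (snd w k))" if "\<phi> \<in> test_functions A" for w \<phi>
    using that configuration_sum_finite[OF finF[OF that] offF]
    by (simp add: T_def S_def \<psi>_def)
  have S_meas: "(\<lambda>w. S \<phi> k (fst w) (snd w k)) \<in> borel_measurable ?\<Omega>"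
    if "\<phi> \<in> test_functions A" for \<phi> k
    unfolding S_def
  proof (rule block_sum_measurable[where N = "N k"])
    show "\<psi> \<phi> k \<in> borel_measurable (N k)" using \<psi>_meas[OF that] by simp
    show "(\<lambda>w. snd w k) \<in> ?\<Omega> \<rightarrow>\<^sub>M block_space (N k)"
      by (rule measurable_compose[OF measurable_snd measurable_component_singleton]) simp
    show "(\<lambda>w. fst w * ?m k) \<in> borel_measurable ?\<Omega>" by measurable
  qed
  have T_meas: "T \<in> ?\<Omega> \<rightarrow>\<^sub>M cylinder_algebra A"
  proof (rule measurable_cylinder_algebraI)
    show "T w \<in> distributions A" for w
      unfolding T_def by (rule configuration_sum_in_distributions[OF A locfin])
    show "(\<lambda>w. T w \<phi>) \<in> borel_measurable ?\<Omega>" if "\<phi> \<in> test_functions A" for \<phi>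
      unfolding T_eq[OF that] by (intro borel_measurable_sum S_meas that)
  qed
  define \<pi> where "\<pi> = distr ?\<Omega> (cylinder_algebra A) T"
  have "characteristic_functional \<pi> \<phi> = C_functional \<alpha> \<mu> \<phi>" if \<phi>: "\<phi> \<in> test_functions A" for \<phi>
  proof -
    let ?E = "\<lambda>t. exp (\<i> * complex_of_real t)"
    let ?Z = "LINT x|\<mu>. (?E (\<phi> x) - 1)"
    note [measurable] = test_meas[OF \<phi>]
    have block: "of_real (?m k) * (LINT x|N k. ?E (\<psi> \<phi> k x) - 1)
        = (LINT x|\<mu>. indicator (B k) x *\<^sub>R (?E (\<phi> x) - 1))" for k
    proof -
      have "(\<lambda>x. ?E (\<psi> \<phi> k x) - 1) \<in> borel_measurable \<mu>"
        using \<psi>_meas[OF \<phi>, of k] by measurable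
      from int_N[OF this]
      have "of_real (?m k) * (LINT x|N k. ?E (\<psi> \<phi> k x) - 1)
          = (LINT x|\<mu>. indicator (B k) x *\<^sub>R (?E (\<psi> \<phi> k x) - 1))" .
      also have "\<dots> = (LINT x|\<mu>. indicator (B k) x *\<^sub>R (?E (\<phi> x) - 1))"
        by (intro Bochner_Integration.integral_cong) (auto simp: \<psi>_def indicator_def)
      finally show ?thesis .
    qed
    have char_block: "(LINT q|block_space (N k). ?E (S \<phi> k r q))
        = exp (of_real r * (LINT x|\<mu>. indicator (B k) x *\<^sub>R (?E (\<phi> x) - 1)))" if r: "r \<ge> 0" for k r
    proof -
      have "(LINT q|block_space (N k). ?E (S \<phi> k r q))
          = exp (of_real (r * ?m k) * (LINT x|N k. ?E (\<psi> \<phi> k x) - 1))"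
        unfolding S_def using \<psi>_meas[OF \<phi>, of k] r
        by (intro block_characteristic_function N) simp_all
      then show ?thesis by (simp add: block[symmetric] mult.assoc)
    qed
    \<comment> \<open>Each point lies in exactly one block. If that block is outside
      \<open>F \<phi>\<close>, then \<phi> vanishes at the point and so does the integrand.\<close>
    have total: "(\<Sum>k\<in>F \<phi>. (LINT x|\<mu>. indicator (B k) x *\<^sub>R (?E (\<phi> x) - 1))) = ?Z"
    proof -
      have "(\<Sum>k\<in>F \<phi>. (LINT x|\<mu>. indicator (B k) x *\<^sub>R (?E (\<phi> x) - 1)))
          = (LINT x|\<mu>. (\<Sum>k\<in>F \<phi>. indicator (B k) x *\<^sub>R (?E (\<phi> x) - 1)))"
      proof (rule Bochner_Integration.integral_sum[symmetric])
        fix k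
        have "norm (?E (\<phi> x) - 1) \<le> 2" for x
          using norm_triangle_ineq4[of "?E (\<phi> x)" 1] by simp
        then show "integrable \<mu> (\<lambda>x. indicator (B k) x *\<^sub>R (?E (\<phi> x) - 1))"
          using finB[of k]
          by (intro integrableI_bounded_set_indicator[where B = 2]) auto
      qed
      also have "\<dots> = ?Z"
      proof (rule Bochner_Integration.integral_cong[OF refl])
        fix x
        obtain k where k: "x \<in> B k" using cov by blast
        have ind: "indicator (B l) x = (if l = k then 1 else 0 :: real)" for l
          using k disj by (auto simp: indicator_def disjoint_family_on_def)
        have "k \<notin> F \<phi> \<Longrightarrow> \<phi> x = 0" using offF k by blast
        then show "(\<Sum>k\<in>F \<phi>. indicator (B k) x *\<^sub>R (?E (\<phi> x) - 1)) = ?E (\<phi> x) - 1"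
          using finF[OF \<phi>] by (auto simp: ind scaleR_sum_left[symmetric])
      qed
      finally show ?thesis .
    qed
    \<comment> \<open>The conditional characteristic functional given intensity \<open>r\<close>:
      independent blocks multiply, and their exponents add up to \<open>r\<close> times
      \<open>?Z\<close>.\<close>
    have inner: "(LINT q|?P. ?E (T (r, q) \<phi>)) = exp (?Z * of_real r)" if r: "r \<ge> 0" for r
    proof -
      have "(LINT q|?P. ?E (T (r, q) \<phi>)) = (LINT q|?P. (\<Prod>k\<in>F \<phi>. ?E (S \<phi> k r (q k))))"
        by (simp add: T_eq[OF \<phi>] sum_distrib_left exp_sum finF[OF \<phi>])
      also have "\<dots> = (\<Prod>k\<in>F \<phi>. (LINT q|block_space (N k). ?E (S \<phi> k r q)))"
      proof (rule P.integral_PiM_prod[OF finF[OF \<phi>]])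
        fix k
        have "S \<phi> k r \<in> borel_measurable (block_space (N k))"
          using block_sum_measurable[of "\<psi> \<phi> k" "N k" "\<lambda>_. r * ?m k" "block_space (N k)" "\<lambda>q. q"]
            \<psi>_meas[OF \<phi>, of k]
          by (simp add: S_def[abs_def])
        then show "integrable (block_space (N k)) (\<lambda>q. ?E (S \<phi> k r q))"
          by (intro P.M.integrable_const_bound[of _ 1]) auto
      qed simp
      also have "\<dots> = exp (\<Sum>k\<in>F \<phi>. of_real r * (LINT x|\<mu>. indicator (B k) x *\<^sub>R (?E (\<phi> x) - 1)))"
        by (simp only: char_block[OF r] exp_sum[OF finF[OF \<phi>]])
      also have "\<dots> = exp (?Z * of_real r)"
        unfolding total[symmetric] by (simp only: sum_distrib_left[symmetric] mult.commute)
      finally show ?thesis .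
    qed
    have ev: "(\<lambda>\<omega>. ?E (\<omega> \<phi>)) \<in> borel_measurable (cylinder_algebra A)"
      using evaluation_measurable[OF \<phi>] by measurable
    have int: "integrable ?\<Omega> (\<lambda>w. ?E (T w \<phi>))"
      using measurable_compose[OF T_meas ev] by (intro \<Omega>.integrable_const_bound[of _ 1]) auto
    have "characteristic_functional \<pi> \<phi> = (LINT w|?\<Omega>. ?E (T w \<phi>))"
      unfolding characteristic_functional_def \<pi>_def by (rule integral_distr[OF T_meas ev])
    also have "\<dots> = (LINT r|L. LINT q|?P. ?E (T (r, q) \<phi>))"
      by (rule \<Omega>.integral_fst'[OF int, symmetric])
    \<comment> \<open>The conditional formula holds for \<open>r \<ge> 0\<close>, hence almost
      everywhere under \<open>L\<close>; the remaining integral is the exponential transform of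
      \<open>L\<close> at \<open>?Z\<close>.\<close>
    also have "\<dots> = (LINT r|L. exp (?Z * of_real r))"
    proof (rule integral_cong_AE)
      show "(\<lambda>r. LINT q|?P. ?E (T (r, q) \<phi>)) \<in> borel_measurable L"
        using \<Omega>.integrable_fst'[OF int] by (rule borel_measurable_integrable)
      show "AE r in L. (LINT q|?P. ?E (T (r, q) \<phi>)) = exp (?Z * of_real r)"
        using L_nonneg by eventually_elim (rule inner)
    qed simp
    also have "\<dots> = C_functional \<alpha> \<mu> \<phi>" by (simp add: L_exp C_functional_def)
    finally show ?thesis .
  qed
  moreover have "prob_space \<pi>" unfolding \<pi>_def by (rule \<Omega>.prob_space_distr[OF T_meas])
  moreover have "space \<pi> = distributions A" "sets \<pi> = sets (cylinder_algebra A)"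
    by (simp_all add: \<pi>_def space_cylinder_algebra)
  ultimately show ?thesis by blast
qed

end
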